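(* Let $(\Pi,G,\psi)$ be an abstract kernel and let $\overline{\xi}\in H^3(\Pi,Z(G))$ be its obstruction. Let $\mathcal S'=(\Pi',C,\xi')$ be the reduced Gr-category of the strict Gr-category $\mathcal A_G$. Then $$\Pi'=\mathrm{Aut}\,G/\mathrm{Int}\,G,\qquad C=Z(G),$$ and $\psi^*\xi'$ belongs to the cohomology class $\overline{\xi}$ of $\xi$, where $(\psi^*\xi')(x,y,z)=\xi'(\psi x,\psi y,\psi z)$.
   Context: Gr-categories. A Gr-category is a monoidal category $(\mathcal C,\otimes,I,a,l,r)$ in which every object is invertible and every arrow is an isomorphism; here $a_{X,Y,Z}:X\otimes(Y\otimes Z)\to(X\otimes Y)\otimes Z$, $l_X:I\otimes X\to X$, $r_X:X\otimes I\to X$. It is strict if $a,l,r$ are identities. Reduced Gr-category. For a Gr-category $\mathcal C$, $\Pi_0(\mathcal C)$ is the group of isomorphism classes of objects under $\otimes$, and $\Pi_1(\mathcal C)=\mathrm{Aut}(I)$ is an abelian group under composition (written $+$). For an object $X$ and $u\in\Pi_1(\mathcal C)$ put $\gamma_X(u)=l_X(u\otimes \mathrm{id}_X)l_X^{-1}$ and $\delta_X(u)=r_X(\mathrm{id}_X\otimes u)r_X^{-1}$. Then $\Pi_1(\mathcal C)$ is a $\Pi_0(\mathcal C)$-module via $su=\gamma_X^{-1}\delta_X(u)$ for any $X\in s$. Choose a stick: a representative $X_s$ of each $s\in\Pi_0(\mathcal C)$ and isomorphisms $i_X:X_s\to X$ for all $X\in s$, with $i_{X_s}=\mathrm{id}$,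 normalized so that $X_1=I$, $i_{I\otimes X_s}=l_{X_s}^{-1}$, $i_{X_s\otimes I}=r_{X_s}^{-1}$. The reduced Gr-category $\mathcal S$ of $\mathcal C$ has objects the elements of $\Pi_0(\mathcal C)$, arrows the automorphisms $(s,u):s\to s$ with $u\in\Pi_1(\mathcal C)$, composition $(s,u).(s,v)=(s,u+v)$, tensor product $s\otimes t=st$, $(s,u)\otimes(t,v)=(st,u+sv)$, identity unit constraints, and associativity constraint $(rst,\xi(r,s,t)):r(st)\to(rs)t$, where $\xi$ is the unique function such that the functor $H:\mathcal S\to\mathcal C$, $H(s)=X_s$, $H(s,u)=\gamma_{X_s}(u)$, with $\widetilde H_{s,t}=i^{-1}_{X_s\otimes X_t}:X_s\otimes X_t\to X_{st}$, is compatible with the associativity constraints. Then $\xi$ is a normalized 3-cocycle of $\Pi_0(\mathcal C)$ with values in $\Pi_1(\mathcal C)$, and $\mathcal S$ is denoted $(\Pi_0(\mathcal C),\Pi_1(\mathcal C),\xi)$. The Gr-category $\mathcal A_G$. Let $G$ be a group, written additively (not necessarily abelian), and let $\mu_c$ denote the inner automorphism $\mu_c(g)=c+g-c$. The objects of $\mathcal A_G$ are the elements of $\mathrm{Aut}(G)$, and $\mathrm{Hom}(\alpha,\beta)=\{c\in G\mid \alpha=\mu_c\circ\beta\}$. The composite of $c:\alpha\to\beta$ and $d:\beta\to\gamma$ is $d\circ c=c+d$ (sum in $G$). The tensor product is $\alpha\otimes\beta=\alpha\circ\beta$ and, for $c:\alpha\to\alpha'$, $d:\beta\to\beta'$, $c\otimes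 d=c+\alpha'(d)$. This is a strict Gr-category. Abstract kernels. An abstract kernel $(\Pi,G,\psi)$ consists of groups $\Pi,G$ and a homomorphism $\psi:\Pi\to\mathrm{Aut}\,G/\mathrm{Int}\,G$, where $\mathrm{Int}\,G$ is the group of inner automorphisms; the center $Z(G)$ is then a $\Pi$-module via $\psi$. Choose $\varphi:\Pi\to\mathrm{Aut}(G)$ with $\varphi(x)\in\psi(x)$, $\varphi(1)=\mathrm{id}_G$, and $f:\Pi^2\to G$ with $\varphi(x)\varphi(y)=\mu_{f(x,y)}\varphi(xy)$. There is a unique 3-cocycle $k:\Pi^3\to Z(G)$ with $$\varphi(x)[f(y,z)]+f(x,yz)=k(x,y,z)+f(x,y)+f(xy,z),$$ and its class $\overline{k}\in H^3(\Pi,Z(G))$, independent of the choices, is the obstruction of the abstract kernel; thus $\overline{\xi}=\overline{k}$, with $\xi$ a 3-cocycle representing it.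
   Formalization: With the stated conventions and C identified with Z(G) by c ↦ c, ψ*ξ' lies in the class −ξ̄, which differs from ξ̄ in general (e.g. Π = Z(G) = Z/3); the formal theorem identifies C with Z(G) by c ↦ −c, so it asserts that −ψ*ξ' belongs to ξ̄. *)

theory Defs
  imports "HOL-Algebra.Bij" "HOL-Algebra.Coset"
begin

section \<open>Monoidal categories and Gr-categories\<close>

text \<open>The associativity constraint is directed from \<open>X \<otimes> (Y \<otimes> Z)\<close> to \<open>(X \<otimes> Y) \<otimes> Z\<close>.
  \<open>Comp C g f\<close> is \<open>g \<circ> f\<close>, for \<open>Cod C f = Dom C g\<close>.\<close>

record ('o, 'm) moncat =
  Obj :: "'o set"
  Arr :: "'m set"
  Dom :: "'m \<Rightarrow> 'o"
  Cod :: "'m \<Rightarrow> 'o"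
  Id :: "'o \<Rightarrow> 'm"
  Comp :: "'m \<Rightarrow> 'm \<Rightarrow> 'm"
  Tens :: "'o \<Rightarrow> 'o \<Rightarrow> 'o"
  TensA :: "'m \<Rightarrow> 'm \<Rightarrow> 'm"
  Unit :: "'o"
  Assoc :: "'o \<Rightarrow> 'o \<Rightarrow> 'o \<Rightarrow> 'm"
  Lunit :: "'o \<Rightarrow> 'm"
  Runit :: "'o \<Rightarrow> 'm"

definition Hom :: "('o, 'm) moncat \<Rightarrow> 'o \<Rightarrow> 'o \<Rightarrow> 'm set" where
  "Hom C X Y = {f \<in> Arr C. Dom C f = X \<and> Cod C f = Y}"

definition inverse_arrows :: "('o, 'm) moncat \<Rightarrow> 'm \<Rightarrow> 'm \<Rightarrow> bool" where
  "inverse_arrows C f g \<longleftrightarrow> f \<in> Arr C \<and> g \<in> Hom C (Cod C f) (Dom C f) \<and>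
     Comp C g f = Id C (Dom C f) \<and> Comp C f g = Id C (Cod C f)"

definition iso_arrow :: "('o, 'm) moncat \<Rightarrow> 'm \<Rightarrow> bool" where
  "iso_arrow C f \<longleftrightarrow> (\<exists>g. inverse_arrows C f g)"

definition inv_arrow :: "('o, 'm) moncat \<Rightarrow> 'm \<Rightarrow> 'm" where
  "inv_arrow C f = (THE g. inverse_arrows C f g)"

definition isomorphic :: "('o, 'm) moncat \<Rightarrow> 'o \<Rightarrow> 'o \<Rightarrow> bool" where
  "isomorphic C X Y \<longleftrightarrow> (\<exists>f \<in> Hom C X Y. iso_arrow C f)"

locale category =
  fixes C :: "('o, 'm) moncat"
  assumes dom_cod: "f \<in> Arr C \<Longrightarrow> Dom C f \<in> Obj C \<and> Cod C f \<in> Obj C"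
    and id_hom: "X \<in> Obj C \<Longrightarrow> Id C X \<in> Hom C X X"
    and comp_hom: "\<lbrakk>f \<in> Hom C X Y; g \<in> Hom C Y Z\<rbrakk> \<Longrightarrow> Comp C g f \<in> Hom C X Z"
    and comp_id: "f \<in> Hom C X Y \<Longrightarrow> Comp C f (Id C X) = f"
    and id_comp: "f \<in> Hom C X Y \<Longrightarrow> Comp C (Id C Y) f = f"
    and comp_assoc: "\<lbrakk>f \<in> Hom C W X; g \<in> Hom C X Y; h \<in> Hom C Y Z\<rbrakk>
          \<Longrightarrow> Comp C h (Comp C g f) = Comp C (Comp C h g) f"

locale monoidal_category = category +
  assumes tens_obj: "\<lbrakk>X \<in> Obj C; Y \<in> Obj C\<rbrakk> \<Longrightarrow> Tens C X Y \<in> Obj C"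
    and tens_hom: "\<lbrakk>f \<in> Hom C X X'; g \<in> Hom C Y Y'\<rbrakk>
          \<Longrightarrow> TensA C f g \<in> Hom C (Tens C X Y) (Tens C X' Y')"
    and tens_id: "\<lbrakk>X \<in> Obj C; Y \<in> Obj C\<rbrakk> \<Longrightarrow> TensA C (Id C X) (Id C Y) = Id C (Tens C X Y)"
    and tens_comp: "\<lbrakk>f \<in> Hom C X X'; f' \<in> Hom C X' X''; g \<in> Hom C Y Y'; g' \<in> Hom C Y' Y''\<rbrakk>
          \<Longrightarrow> TensA C (Comp C f' f) (Comp C g' g) = Comp C (TensA C f' g') (TensA C f g)"
    and unit_obj: "Unit C \<in> Obj C"
    and assoc_hom: "\<lbrakk>X \<in> Obj C; Y \<in> Obj C; Z \<in> Obj C\<rbrakk>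
          \<Longrightarrow> Assoc C X Y Z \<in> Hom C (Tens C X (Tens C Y Z)) (Tens C (Tens C X Y) Z)"
    and assoc_iso: "\<lbrakk>X \<in> Obj C; Y \<in> Obj C; Z \<in> Obj C\<rbrakk> \<Longrightarrow> iso_arrow C (Assoc C X Y Z)"
    and assoc_nat: "\<lbrakk>f \<in> Hom C X X'; g \<in> Hom C Y Y'; h \<in> Hom C Z Z'\<rbrakk>
          \<Longrightarrow> Comp C (Assoc C X' Y' Z') (TensA C f (TensA C g h))
            = Comp C (TensA C (TensA C f g) h) (Assoc C X Y Z)"
    and lunit_hom: "X \<in> Obj C \<Longrightarrow> Lunit C X \<in> Hom C (Tens C (Unit C) X) X"
    and lunit_iso: "X \<in> Obj C \<Longrightarrow> iso_arrow C (Lunit C X)"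
    and lunit_nat: "f \<in> Hom C X X'
          \<Longrightarrow> Comp C (Lunit C X') (TensA C (Id C (Unit C)) f) = Comp C f (Lunit C X)"
    and runit_hom: "X \<in> Obj C \<Longrightarrow> Runit C X \<in> Hom C (Tens C X (Unit C)) X"
    and runit_iso: "X \<in> Obj C \<Longrightarrow> iso_arrow C (Runit C X)"
    and runit_nat: "f \<in> Hom C X X'
          \<Longrightarrow> Comp C (Runit C X') (TensA C f (Id C (Unit C))) = Comp C f (Runit C X)"
    and pentagon: "\<lbrakk>W \<in> Obj C; X \<in> Obj C; Y \<in> Obj C; Z \<in> Obj C\<rbrakk>
          \<Longrightarrow> Comp C (Assoc C (Tens C W X) Y Z) (Assoc C W X (Tens C Y Z))
            = Comp C (TensA C (Assoc C W X Y) (Id C Z))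
                (Comp C (Assoc C W (Tens C X Y) Z) (TensA C (Id C W) (Assoc C X Y Z)))"
    and triangle: "\<lbrakk>X \<in> Obj C; Y \<in> Obj C\<rbrakk>
          \<Longrightarrow> Comp C (TensA C (Runit C X) (Id C Y)) (Assoc C X (Unit C) Y)
            = TensA C (Id C X) (Lunit C Y)"

locale gr_category = monoidal_category +
  assumes arrows_iso: "f \<in> Arr C \<Longrightarrow> iso_arrow C f"
    and objects_inv: "X \<in> Obj C \<Longrightarrow>
          \<exists>Y \<in> Obj C. isomorphic C (Tens C X Y) (Unit C) \<and> isomorphic C (Tens C Y X) (Unit C)"

locale strict_gr_category = gr_category +
  assumes strict_assoc: "\<lbrakk>X \<in> Obj C; Y \<in> Obj C; Z \<in> Obj C\<rbrakk>
          \<Longrightarrow> Tens C X (Tens C Y Z) = Tens C (Tens C X Y) Z \<and>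
              Assoc C X Y Z = Id C (Tens C X (Tens C Y Z))"
    and strict_lunit: "X \<in> Obj C \<Longrightarrow> Tens C (Unit C) X = X \<and> Lunit C X = Id C X"
    and strict_runit: "X \<in> Obj C \<Longrightarrow> Tens C X (Unit C) = X \<and> Runit C X = Id C X"


section \<open>The reduced Gr-category\<close>

definition iso_class :: "('o, 'm) moncat \<Rightarrow> 'o \<Rightarrow> 'o set" where
  "iso_class C X = {Y \<in> Obj C. isomorphic C X Y}"

definition Pi0 :: "('o, 'm) moncat \<Rightarrow> 'o set monoid" where
  "Pi0 C = \<lparr>carrier = iso_class C ` Obj C,
            mult = (\<lambda>s t. \<Union>X\<in>s. \<Union>Y\<in>t. iso_class C (Tens C X Y)),
            one = iso_class C (Unit C)\<rparr>"

definition Pi1 :: "('o, 'm) moncat \<Rightarrow> 'm monoid" where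
  "Pi1 C = \<lparr>carrier = {u \<in> Hom C (Unit C) (Unit C). iso_arrow C u},
            mult = Comp C,
            one = Id C (Unit C)\<rparr>"

definition gamma :: "('o, 'm) moncat \<Rightarrow> 'o \<Rightarrow> 'm \<Rightarrow> 'm" where
  "gamma C X u = Comp C (Lunit C X) (Comp C (TensA C u (Id C X)) (inv_arrow C (Lunit C X)))"

definition delta :: "('o, 'm) moncat \<Rightarrow> 'o \<Rightarrow> 'm \<Rightarrow> 'm" where
  "delta C X u = Comp C (Runit C X) (Comp C (TensA C (Id C X) u) (inv_arrow C (Runit C X)))"

definition Pi_act :: "('o, 'm) moncat \<Rightarrow> 'o set \<Rightarrow> 'm \<Rightarrow> 'm" where
  "Pi_act C s u = (THE v. v \<in> carrier (Pi1 C) \<and> (\<forall>X\<in>s. gamma C X v = delta C X u))"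

definition stick :: "('o, 'm) moncat \<Rightarrow> ('o set \<Rightarrow> 'o) \<Rightarrow> ('o \<Rightarrow> 'm) \<Rightarrow> bool" where
  "stick C X i \<longleftrightarrow>
     (\<forall>s \<in> carrier (Pi0 C). X s \<in> s) \<and>
     (\<forall>s \<in> carrier (Pi0 C). \<forall>Y \<in> s. i Y \<in> Hom C (X s) Y \<and> iso_arrow C (i Y)) \<and>
     (\<forall>s \<in> carrier (Pi0 C). i (X s) = Id C (X s)) \<and>
     X \<one>\<^bsub>Pi0 C\<^esub> = Unit C \<and>
     (\<forall>s \<in> carrier (Pi0 C). i (Tens C (Unit C) (X s)) = inv_arrow C (Lunit C (X s))) \<and>
     (\<forall>s \<in> carrier (Pi0 C). i (Tens C (X s) (Unit C)) = inv_arrow C (Runit C (X s)))"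

text \<open>The Gr-category \<open>(P, A, \<xi>)\<close>, where \<open>P\<close> acts on \<open>A\<close> by \<open>act\<close>: all arrows are
  automorphisms \<open>(s, u) : s \<rightarrow> s\<close>. Cochains of three arguments are functions on triples.\<close>

definition gr_type ::
  "('s, 'c) monoid_scheme \<Rightarrow> ('u, 'd) monoid_scheme \<Rightarrow> ('s \<Rightarrow> 'u \<Rightarrow> 'u) \<Rightarrow>
   ('s \<times> 's \<times> 's \<Rightarrow> 'u) \<Rightarrow> ('s, 's \<times> 'u) moncat" where
  "gr_type P A act \<xi> =
     \<lparr>Obj = carrier P,
      Arr = carrier P \<times> carrier A,
      Dom = fst,
      Cod = fst,
      Id = (\<lambda>s. (s, \<one>\<^bsub>A\<^esub>)),
      Comp = (\<lambda>(s, u) (t, v). (s, u \<otimes>\<^bsub>A\<^esub> v)),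
      Tens = (\<lambda>s t. s \<otimes>\<^bsub>P\<^esub> t),
      TensA = (\<lambda>(s, u) (t, v). (s \<otimes>\<^bsub>P\<^esub> t, u \<otimes>\<^bsub>A\<^esub> act s v)),
      Unit = \<one>\<^bsub>P\<^esub>,
      Assoc = (\<lambda>r s t. ((r \<otimes>\<^bsub>P\<^esub> s) \<otimes>\<^bsub>P\<^esub> t, \<xi> (r, s, t))),
      Lunit = (\<lambda>s. (s, \<one>\<^bsub>A\<^esub>)),
      Runit = (\<lambda>s. (s, \<one>\<^bsub>A\<^esub>))\<rparr>"

text \<open>Compatibility of \<open>(F, F\<^sub>2)\<close>, with \<open>F\<^sub>2 X Y : F X \<otimes> F Y \<rightarrow> F (X \<otimes> Y)\<close>, with the
  associativity constraints: the two composites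
  \<open>F X \<otimes> (F Y \<otimes> F Z) \<rightarrow> F ((X \<otimes> Y) \<otimes> Z)\<close> agree.\<close>

definition assoc_compatible ::
  "('o, 'm) moncat \<Rightarrow> ('p, 'n) moncat \<Rightarrow> ('o \<Rightarrow> 'p) \<Rightarrow> ('m \<Rightarrow> 'n) \<Rightarrow> ('o \<Rightarrow> 'o \<Rightarrow> 'n) \<Rightarrow> bool" where
  "assoc_compatible S C F FA F2 \<longleftrightarrow>
     (\<forall>X \<in> Obj S. \<forall>Y \<in> Obj S. \<forall>Z \<in> Obj S.
        Comp C (FA (Assoc S X Y Z))
          (Comp C (F2 X (Tens S Y Z)) (TensA C (Id C (F X)) (F2 Y Z)))
      = Comp C (F2 (Tens S X Y) Z)
          (Comp C (TensA C (F2 X Y) (Id C (F Z))) (Assoc C (F X) (F Y) (F Z))))"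

definition reduced_cocycle ::
  "('o, 'm) moncat \<Rightarrow> ('o set \<Rightarrow> 'o) \<Rightarrow> ('o \<Rightarrow> 'm) \<Rightarrow> 'o set \<times> 'o set \<times> 'o set \<Rightarrow> 'm" where
  "reduced_cocycle C X i =
     (THE \<xi>. \<xi> \<in> carrier (Pi0 C) \<times> carrier (Pi0 C) \<times> carrier (Pi0 C) \<rightarrow>\<^sub>E carrier (Pi1 C) \<and>
        assoc_compatible (gr_type (Pi0 C) (Pi1 C) (Pi_act C) \<xi>) C
          X (\<lambda>(s, u). gamma C (X s) u) (\<lambda>s t. inv_arrow C (i (Tens C (X s) (X t)))))"

text \<open>The reduced Gr-category as its triple of invariants; the category itself is
  \<open>gr_type (Pi0 C) (Pi1 C) (Pi_act C) (reduced_cocycle C X i)\<close>.\<close>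

definition reduced_gr ::
  "('o, 'm) moncat \<Rightarrow> ('o set \<Rightarrow> 'o) \<Rightarrow> ('o \<Rightarrow> 'm) \<Rightarrow>
   'o set monoid \<times> 'm monoid \<times> ('o set \<times> 'o set \<times> 'o set \<Rightarrow> 'm)" where
  "reduced_gr C X i = (Pi0 C, Pi1 C, reduced_cocycle C X i)"


section \<open>Third cohomology of a group\<close>

text \<open>Cochains are extensional functions, so that cohomology classes are literally cosets.
  The coefficient group \<open>A\<close> is abelian and written multiplicatively.\<close>

definition cochains2 where
  "cochains2 P A = (carrier P \<times> carrier P \<rightarrow>\<^sub>E carrier A)"

definition cochains3 where
  "cochains3 P A = (carrier P \<times> carrier P \<times> carrier P \<rightarrow>\<^sub>E carrier A)"

definition coboundary2 ::
  "('p, 'c) monoid_scheme \<Rightarrow> ('a, 'd) monoid_scheme \<Rightarrow> ('p \<Rightarrow> 'a \<Rightarrow> 'a) \<Rightarrow>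
   ('p \<times> 'p \<Rightarrow> 'a) \<Rightarrow> 'p \<times> 'p \<times> 'p \<Rightarrow> 'a" where
  "coboundary2 P A act g = (\<lambda>(x, y, z) \<in> carrier P \<times> carrier P \<times> carrier P.
     act x (g (y, z)) \<otimes>\<^bsub>A\<^esub> inv\<^bsub>A\<^esub> g (x \<otimes>\<^bsub>P\<^esub> y, z) \<otimes>\<^bsub>A\<^esub> g (x, y \<otimes>\<^bsub>P\<^esub> z) \<otimes>\<^bsub>A\<^esub> inv\<^bsub>A\<^esub> g (x, y))"

definition cocycle3 ::
  "('p, 'c) monoid_scheme \<Rightarrow> ('a, 'd) monoid_scheme \<Rightarrow> ('p \<Rightarrow> 'a \<Rightarrow> 'a) \<Rightarrow>
   ('p \<times> 'p \<times> 'p \<Rightarrow> 'a) \<Rightarrow> bool" where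
  "cocycle3 P A act k \<longleftrightarrow> k \<in> cochains3 P A \<and>
     (\<forall>x \<in> carrier P. \<forall>y \<in> carrier P. \<forall>z \<in> carrier P. \<forall>t \<in> carrier P.
        act x (k (y, z, t)) \<otimes>\<^bsub>A\<^esub> inv\<^bsub>A\<^esub> k (x \<otimes>\<^bsub>P\<^esub> y, z, t) \<otimes>\<^bsub>A\<^esub> k (x, y \<otimes>\<^bsub>P\<^esub> z, t)
          \<otimes>\<^bsub>A\<^esub> inv\<^bsub>A\<^esub> k (x, y, z \<otimes>\<^bsub>P\<^esub> t) \<otimes>\<^bsub>A\<^esub> k (x, y, z) = \<one>\<^bsub>A\<^esub>)"

definition Z3 ::
  "('p, 'c) monoid_scheme \<Rightarrow> ('a, 'd) monoid_scheme \<Rightarrow> ('p \<Rightarrow> 'a \<Rightarrow> 'a) \<Rightarrow>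
   ('p \<times> 'p \<times> 'p \<Rightarrow> 'a) monoid" where
  "Z3 P A act =
     \<lparr>carrier = {k. cocycle3 P A act k},
      mult = (\<lambda>k l. \<lambda>w \<in> carrier P \<times> carrier P \<times> carrier P. k w \<otimes>\<^bsub>A\<^esub> l w),
      one = (\<lambda>w \<in> carrier P \<times> carrier P \<times> carrier P. \<one>\<^bsub>A\<^esub>)\<rparr>"

definition B3 where
  "B3 P A act = coboundary2 P A act ` cochains2 P A"

definition H3 where
  "H3 P A act = Z3 P A act Mod B3 P A act"


section \<open>Abstract kernels and the Gr-category of automorphisms\<close>

text \<open>The group \<open>G\<close> is written multiplicatively. Automorphisms are extensional on
  \<open>carrier G\<close>, as in \<^const>\<open>auto\<close>.\<close>

definition conj_aut :: "('g, 'b) monoid_scheme \<Rightarrow> 'g \<Rightarrow> 'g \<Rightarrow> 'g" where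
  "conj_aut G c = (\<lambda>g \<in> carrier G. c \<otimes>\<^bsub>G\<^esub> g \<otimes>\<^bsub>G\<^esub> inv\<^bsub>G\<^esub> c)"

definition Int_aut :: "('g, 'b) monoid_scheme \<Rightarrow> ('g \<Rightarrow> 'g) set" where
  "Int_aut G = conj_aut G ` carrier G"

definition Out :: "('g, 'b) monoid_scheme \<Rightarrow> ('g \<Rightarrow> 'g) set monoid" where
  "Out G = AutoGroup G Mod Int_aut G"

definition Center :: "('g, 'b) monoid_scheme \<Rightarrow> ('g, 'b) monoid_scheme" where
  "Center G = G\<lparr>carrier := {c \<in> carrier G. \<forall>g \<in> carrier G. c \<otimes>\<^bsub>G\<^esub> g = g \<otimes>\<^bsub>G\<^esub> c}\<rparr>"

text \<open>All members of an outer class restrict to the same automorphism of the center.\<close>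

definition Out_act :: "('g \<Rightarrow> 'g) set \<Rightarrow> 'g \<Rightarrow> 'g" where
  "Out_act s c = (THE d. \<forall>\<alpha> \<in> s. \<alpha> c = d)"

definition aut_gr :: "('g, 'b) monoid_scheme \<Rightarrow> ('g \<Rightarrow> 'g, ('g \<Rightarrow> 'g) \<times> 'g \<times> ('g \<Rightarrow> 'g)) moncat" where
  \<comment> \<open>the arrow \<open>c : \<alpha> \<rightarrow> \<beta>\<close> is the triple \<open>(\<alpha>, c, \<beta>)\<close>\<close>
  "aut_gr G =
     \<lparr>Obj = auto G,
      Arr = {(\<alpha>, c, \<beta>). \<alpha> \<in> auto G \<and> \<beta> \<in> auto G \<and> c \<in> carrier G \<and>
                        \<alpha> = compose (carrier G) (conj_aut G c) \<beta>},
      Dom = (\<lambda>(\<alpha>, c, \<beta>). \<alpha>),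
      Cod = (\<lambda>(\<alpha>, c, \<beta>). \<beta>),
      Id = (\<lambda>\<alpha>. (\<alpha>, \<one>\<^bsub>G\<^esub>, \<alpha>)),
      Comp = (\<lambda>(\<beta>', d, \<gamma>) (\<alpha>, c, \<beta>). (\<alpha>, c \<otimes>\<^bsub>G\<^esub> d, \<gamma>)),
      Tens = compose (carrier G),
      TensA = (\<lambda>(\<alpha>, c, \<alpha>') (\<beta>, d, \<beta>').
                 (compose (carrier G) \<alpha> \<beta>, c \<otimes>\<^bsub>G\<^esub> \<alpha>' d, compose (carrier G) \<alpha>' \<beta>')),
      Unit = (\<lambda>g \<in> carrier G. g),
      Assoc = (\<lambda>\<alpha> \<beta> \<gamma>. let \<delta> = compose (carrier G) \<alpha> (compose (carrier G) \<beta> \<gamma>) in (\<delta>, \<one>\<^bsub>G\<^esub>, \<delta>)),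
      Lunit = (\<lambda>\<alpha>. (\<alpha>, \<one>\<^bsub>G\<^esub>, \<alpha>)),
      Runit = (\<lambda>\<alpha>. (\<alpha>, \<one>\<^bsub>G\<^esub>, \<alpha>))\<rparr>"

context group
begin

lemma auto_closed: "\<alpha> \<in> auto G \<Longrightarrow> x \<in> carrier G \<Longrightarrow> \<alpha> x \<in> carrier G"
  by (auto simp: auto_def hom_def)

lemma auto_mult: "\<alpha> \<in> auto G \<Longrightarrow> x \<in> carrier G \<Longrightarrow> y \<in> carrier G \<Longrightarrow> \<alpha> (x \<otimes> y) = \<alpha> x \<otimes> \<alpha> y"
  by (auto simp: auto_def hom_def)

lemma auto_one: "\<alpha> \<in> auto G \<Longrightarrow> \<alpha> \<one> = \<one>"
  by (metis auto_closed auto_mult l_one l_cancel_one one_closed)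

lemma auto_inv: "\<alpha> \<in> auto G \<Longrightarrow> x \<in> carrier G \<Longrightarrow> \<alpha> (inv x) = inv \<alpha> x"
  by (metis auto_closed auto_mult auto_one inv_closed inv_equality l_inv)

lemma auto_ext: "\<alpha> \<in> auto G \<Longrightarrow> \<alpha> \<in> extensional (carrier G)"
  by (auto simp: auto_def Bij_def)

lemma auto_compose: "\<alpha> \<in> auto G \<Longrightarrow> \<beta> \<in> auto G \<Longrightarrow> compose (carrier G) \<alpha> \<beta> \<in> auto G"
  using group.hom_compose[OF is_group, of \<beta> G \<alpha> G] by (simp add: auto_def compose_Bij)

lemma auto_inverse:
  assumes "\<alpha> \<in> auto G"
  obtains \<beta> where "\<beta> \<in> auto G" "compose (carrier G) \<alpha> \<beta> = (\<lambda>g \<in> carrier G. g)"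
    "compose (carrier G) \<beta> \<alpha> = (\<lambda>g \<in> carrier G. g)"
proof
  let ?b = "restrict (inv_into (carrier G) \<alpha>) (carrier G)"
  show "?b \<in> auto G"
    using assms by (simp add: auto_def restrict_inv_into_Bij restrict_inv_into_hom)
  show "compose (carrier G) ?b \<alpha> = (\<lambda>g \<in> carrier G. g)"
    using assms by (simp add: auto_def Bij_compose_restrict_eq)
  show "compose (carrier G) \<alpha> ?b = (\<lambda>g \<in> carrier G. g)"
    using assms by (auto simp: auto_def Bij_def compose_def bij_betw_def f_inv_into_f)
qed

lemma compose_conj_aut:
  assumes "\<alpha> \<in> auto G" "\<beta> \<in> auto G"
  shows "\<alpha> = compose (carrier G) (conj_aut G c) \<beta> \<longleftrightarrow>
    (\<forall>g \<in> carrier G. \<alpha> g = c \<otimes> \<beta> g \<otimes> inv c)"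
proof
  assume r: "\<forall>g \<in> carrier G. \<alpha> g = c \<otimes> \<beta> g \<otimes> inv c"
  show "\<alpha> = compose (carrier G) (conj_aut G c) \<beta>"
    by (rule extensionalityI[OF auto_ext[OF assms(1)] compose_extensional])
      (use assms r in \<open>simp add: compose_def conj_aut_def auto_closed\<close>)
next
  assume l: "\<alpha> = compose (carrier G) (conj_aut G c) \<beta>"
  show "\<forall>g \<in> carrier G. \<alpha> g = c \<otimes> \<beta> g \<otimes> inv c"
    by (subst l) (use assms in \<open>simp add: compose_def conj_aut_def auto_closed\<close>)
qed

lemma Arr_aut_gr:
  "Arr (aut_gr G) = {(\<alpha>, c, \<beta>). \<alpha> \<in> auto G \<and> \<beta> \<in> auto G \<and> c \<in> carrier G \<and>
     (\<forall>g \<in> carrier G. \<alpha> g = c \<otimes> \<beta> g \<otimes> inv c)}"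
proof -
  have "(\<alpha> \<in> auto G \<and> \<beta> \<in> auto G \<and> c \<in> carrier G \<and> \<alpha> = compose (carrier G) (conj_aut G c) \<beta>) \<longleftrightarrow>
    (\<alpha> \<in> auto G \<and> \<beta> \<in> auto G \<and> c \<in> carrier G \<and> (\<forall>g \<in> carrier G. \<alpha> g = c \<otimes> \<beta> g \<otimes> inv c))"
    for \<alpha> \<beta> c
    using compose_conj_aut by blast
  then show ?thesis by (simp add: aut_gr_def)
qed

lemma Hom_aut_gr:
  "Hom (aut_gr G) \<alpha> \<beta> = {(\<alpha>, c, \<beta>) |c. \<alpha> \<in> auto G \<and> \<beta> \<in> auto G \<and> c \<in> carrier G \<and>
     (\<forall>g \<in> carrier G. \<alpha> g = c \<otimes> \<beta> g \<otimes> inv c)}"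
  unfolding Hom_def Arr_aut_gr by (auto simp: aut_gr_def)

lemma conj_cancel:
  assumes "c \<in> carrier G" "x \<in> carrier G"
  shows "inv c \<otimes> (c \<otimes> x \<otimes> inv c) \<otimes> c = x"
  using assms by (simp add: m_assoc inv_solve_left')

lemma iso_arrow_aut_gr: "iso_arrow (aut_gr G) f \<longleftrightarrow> f \<in> Arr (aut_gr G)"
proof
  assume "f \<in> Arr (aut_gr G)"
  then obtain \<alpha> c \<beta> where f: "f = (\<alpha>, c, \<beta>)" "\<alpha> \<in> auto G" "\<beta> \<in> auto G" "c \<in> carrier G"
    "\<forall>g \<in> carrier G. \<alpha> g = c \<otimes> \<beta> g \<otimes> inv c"
    by (auto simp: Arr_aut_gr)
  have "inverse_arrows (aut_gr G) f (\<beta>, inv c, \<alpha>)"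
    unfolding inverse_arrows_def Arr_aut_gr Hom_aut_gr
    using f by (simp add: aut_gr_def conj_cancel auto_closed)
  then show "iso_arrow (aut_gr G) f"
    unfolding iso_arrow_def by blast
qed (auto simp: iso_arrow_def inverse_arrows_def)

lemma Id_aut_gr_hom: "\<alpha> \<in> auto G \<Longrightarrow> (\<alpha>, \<one>, \<alpha>) \<in> Hom (aut_gr G) \<alpha> \<alpha>"
  by (auto simp: Hom_aut_gr auto_closed)

lemma compose_assoc_auto:
  "\<lbrakk>\<alpha> \<in> auto G; \<beta> \<in> auto G; \<gamma> \<in> auto G\<rbrakk> \<Longrightarrow>
   compose (carrier G) (compose (carrier G) \<alpha> \<beta>) \<gamma> = compose (carrier G) \<alpha> (compose (carrier G) \<beta> \<gamma>)"
  by (metis compose_assoc auto_closed Pi_I)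

lemma compose_Id_auto:
  "\<alpha> \<in> auto G \<Longrightarrow> compose (carrier G) (\<lambda>g\<in>carrier G. g) \<alpha> = \<alpha>"
  "\<alpha> \<in> auto G \<Longrightarrow> compose (carrier G) \<alpha> (\<lambda>g\<in>carrier G. g) = \<alpha>"
  by (auto intro!: Id_compose compose_Id simp: auto_ext auto_closed)

theorem strict_gr_category_aut_gr: "strict_gr_category (aut_gr G)"
proof -
  let ?C = "aut_gr G"
  have obj: "Obj ?C = auto G"
    and id: "Id ?C = (\<lambda>\<alpha>. (\<alpha>, \<one>, \<alpha>))"
    and comp: "\<And>\<alpha> c \<beta> \<beta>' d \<gamma>. Comp ?C (\<beta>', d, \<gamma>) (\<alpha>, c, \<beta>) = (\<alpha>, c \<otimes> d, \<gamma>)"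
    and tens: "Tens ?C = compose (carrier G)"
    and tensA: "\<And>\<alpha> c \<alpha>' \<beta> d \<beta>'. TensA ?C (\<alpha>, c, \<alpha>') (\<beta>, d, \<beta>') =
       (compose (carrier G) \<alpha> \<beta>, c \<otimes> \<alpha>' d, compose (carrier G) \<alpha>' \<beta>')"
    and unit: "Unit ?C = (\<lambda>g \<in> carrier G. g)"
    and assoc: "\<And>\<alpha> \<beta> \<gamma>. Assoc ?C \<alpha> \<beta> \<gamma> =
       (compose (carrier G) \<alpha> (compose (carrier G) \<beta> \<gamma>), \<one>,
        compose (carrier G) \<alpha> (compose (carrier G) \<beta> \<gamma>))"
    and lunit: "Lunit ?C = (\<lambda>\<alpha>. (\<alpha>, \<one>, \<alpha>))"
    and runit: "Runit ?C = (\<lambda>\<alpha>. (\<alpha>, \<one>, \<alpha>))"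
    by (auto simp: aut_gr_def Let_def)
  note C = obj id comp tens tensA unit assoc lunit runit
  have HomE: "\<exists>c. f = (\<alpha>, c, \<beta>) \<and> \<alpha> \<in> auto G \<and> \<beta> \<in> auto G \<and> c \<in> carrier G \<and>
     (\<forall>g \<in> carrier G. \<alpha> g = c \<otimes> \<beta> g \<otimes> inv c)" if "f \<in> Hom ?C \<alpha> \<beta>" for f \<alpha> \<beta>
    using that by (auto simp: Hom_aut_gr)
  have conj_mult: "c \<otimes> (d \<otimes> x \<otimes> inv d) \<otimes> inv c = c \<otimes> d \<otimes> x \<otimes> inv (c \<otimes> d)"
    if "c \<in> carrier G" "d \<in> carrier G" "x \<in> carrier G" for c d x
    using that by (simp add: m_assoc inv_mult_group)
  have comp_hom: "Comp ?C g f \<in> Hom ?C X Z" if "f \<in> Hom ?C X Y" "g \<in> Hom ?C Y Z" for f g X Y Z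
    using HomE[OF that(1)] HomE[OF that(2)]
    by (auto simp: C Hom_aut_gr conj_mult auto_closed)
  interpret category ?C
  proof
    fix f assume "f \<in> Arr ?C"
    then show "Dom ?C f \<in> Obj ?C \<and> Cod ?C f \<in> Obj ?C"
      by (auto simp: aut_gr_def)
  next
    fix X assume "X \<in> Obj ?C"
    then show "Id ?C X \<in> Hom ?C X X" by (simp add: C Id_aut_gr_hom)
  next
    fix f g X Y Z assume "f \<in> Hom ?C X Y" "g \<in> Hom ?C Y Z"
    then show "Comp ?C g f \<in> Hom ?C X Z" by (rule comp_hom)
  next
    fix f X Y assume "f \<in> Hom ?C X Y"
    then show "Comp ?C f (Id ?C X) = f" "Comp ?C (Id ?C Y) f = f"
      by (auto dest!: HomE simp: C)
  next
    fix f g h W X Y Z assume "f \<in> Hom ?C W X" "g \<in> Hom ?C X Y" "h \<in> Hom ?C Y Z"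
    then show "Comp ?C h (Comp ?C g f) = Comp ?C (Comp ?C h g) f"
      by (auto dest!: HomE simp: C m_assoc)
  qed
  have tens_hom: "TensA ?C f g \<in> Hom ?C (Tens ?C X Y) (Tens ?C X' Y')"
    if fg: "f \<in> Hom ?C X X'" "g \<in> Hom ?C Y Y'" for f g X X' Y Y'
  proof -
    obtain c where c: "f = (X, c, X')" "X \<in> auto G" "X' \<in> auto G" "c \<in> carrier G"
      "\<forall>g \<in> carrier G. X g = c \<otimes> X' g \<otimes> inv c" using HomE[OF fg(1)] by blast
    obtain d where d: "g = (Y, d, Y')" "Y \<in> auto G" "Y' \<in> auto G" "d \<in> carrier G"
      "\<forall>g \<in> carrier G. Y g = d \<otimes> Y' g \<otimes> inv d" using HomE[OF fg(2)] by blast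
    have "X (Y x) = c \<otimes> X' d \<otimes> X' (Y' x) \<otimes> inv (c \<otimes> X' d)" if "x \<in> carrier G" for x
    proof -
      have "X (Y x) = c \<otimes> X' (d \<otimes> Y' x \<otimes> inv d) \<otimes> inv c"
        using that c(5) d by (simp add: auto_closed)
      also have "\<dots> = c \<otimes> (X' d \<otimes> X' (Y' x) \<otimes> inv X' d) \<otimes> inv c"
        using that c(3) d by (simp add: auto_closed auto_mult auto_inv)
      finally show ?thesis
        using that c(3,4) d by (simp add: auto_closed conj_mult)
    qed
    then show ?thesis
      using c(3,4) d(4) auto_compose[OF c(2) d(2)] auto_compose[OF c(3) d(3)]
      by (simp add: c(1) d(1) tens tensA Hom_aut_gr auto_closed compose_eq)
  qed
  have hom_arr: "f \<in> Hom ?C X Y \<Longrightarrow> iso_arrow ?C f" for f X Y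
    by (simp add: iso_arrow_aut_gr Hom_def)
  interpret monoidal_category ?C
  proof
    fix X Y assume XY: "X \<in> Obj ?C" "Y \<in> Obj ?C"
    then show "Tens ?C X Y \<in> Obj ?C" by (simp add: C auto_compose)
    show "TensA ?C (Id ?C X) (Id ?C Y) = Id ?C (Tens ?C X Y)"
      using XY by (simp add: C auto_one)
    show "Comp ?C (TensA ?C (Runit ?C X) (Id ?C Y)) (Assoc ?C X (Unit ?C) Y)
            = TensA ?C (Id ?C X) (Lunit ?C Y)"
      using XY by (simp add: C auto_one compose_Id_auto)
  next
    fix f g X X' Y Y' assume "f \<in> Hom ?C X X'" "g \<in> Hom ?C Y Y'"
    then show "TensA ?C f g \<in> Hom ?C (Tens ?C X Y) (Tens ?C X' Y')" by (rule tens_hom)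
  next
    fix f f' g g' X X' X'' Y Y' Y''
    assume f: "f \<in> Hom ?C X X'" and f': "f' \<in> Hom ?C X' X''"
      and g: "g \<in> Hom ?C Y Y'" and g': "g' \<in> Hom ?C Y' Y''"
    obtain c where c: "f = (X, c, X')" "c \<in> carrier G" "X' \<in> auto G" using HomE[OF f] by blast
    obtain c' where c': "f' = (X', c', X'')" "c' \<in> carrier G" "X'' \<in> auto G"
       "\<forall>g \<in> carrier G. X' g = c' \<otimes> X'' g \<otimes> inv c'" using HomE[OF f'] by blast
    obtain d where d: "g = (Y, d, Y')" "d \<in> carrier G" using HomE[OF g] by blast
    obtain d' where d': "g' = (Y', d', Y'')" "d' \<in> carrier G" using HomE[OF g'] by blast
    have "c \<otimes> c' \<otimes> X'' (d \<otimes> d') = c \<otimes> X' d \<otimes> (c' \<otimes> X'' d')"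
      using c c' d d' by (simp add: auto_mult auto_closed m_assoc flip: m_assoc[of "inv c'" c'])
    then show "TensA ?C (Comp ?C f' f) (Comp ?C g' g) = Comp ?C (TensA ?C f' g') (TensA ?C f g)"
      by (simp add: C c(1) c'(1) d(1) d'(1))
  next
    show "Unit ?C \<in> Obj ?C" by (simp add: C id_in_auto)
  next
    fix X Y Z assume "X \<in> Obj ?C" "Y \<in> Obj ?C" "Z \<in> Obj ?C"
    then show "Assoc ?C X Y Z \<in> Hom ?C (Tens ?C X (Tens ?C Y Z)) (Tens ?C (Tens ?C X Y) Z)"
      by (simp add: C compose_assoc_auto Id_aut_gr_hom auto_compose)
    then show "iso_arrow ?C (Assoc ?C X Y Z)" by (rule hom_arr)
  next
    fix f g h X X' Y Y' Z Z'
    assume f: "f \<in> Hom ?C X X'" and g: "g \<in> Hom ?C Y Y'" and h: "h \<in> Hom ?C Z Z'"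
    obtain c where c: "f = (X, c, X')" "c \<in> carrier G" "X \<in> auto G" "X' \<in> auto G"
      using HomE[OF f] by blast
    obtain d where d: "g = (Y, d, Y')" "d \<in> carrier G" "Y \<in> auto G" "Y' \<in> auto G"
      using HomE[OF g] by blast
    obtain e where e: "h = (Z, e, Z')" "e \<in> carrier G" "Z \<in> auto G" "Z' \<in> auto G"
      using HomE[OF h] by blast
    show "Comp ?C (Assoc ?C X' Y' Z') (TensA ?C f (TensA ?C g h))
            = Comp ?C (TensA ?C (TensA ?C f g) h) (Assoc ?C X Y Z)"
      using c(2-) d(2-) e(2-)
      by (simp add: c(1) d(1) e(1) C compose_assoc_auto auto_mult auto_closed m_assoc compose_eq)
  next
    fix X assume X: "X \<in> Obj ?C"
    then show "Lunit ?C X \<in> Hom ?C (Tens ?C (Unit ?C) X) X"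
      "Runit ?C X \<in> Hom ?C (Tens ?C X (Unit ?C)) X"
      by (auto simp: C compose_Id_auto Id_aut_gr_hom)
    then show "iso_arrow ?C (Lunit ?C X)" "iso_arrow ?C (Runit ?C X)" by (auto intro: hom_arr)
  next
    fix f X X' assume f: "f \<in> Hom ?C X X'"
    then show "Comp ?C (Lunit ?C X') (TensA ?C (Id ?C (Unit ?C)) f) = Comp ?C f (Lunit ?C X)"
      "Comp ?C (Runit ?C X') (TensA ?C f (Id ?C (Unit ?C))) = Comp ?C f (Runit ?C X)"
      by (auto dest!: HomE simp: C compose_Id_auto auto_one)
  next
    fix W X Y Z assume "W \<in> Obj ?C" "X \<in> Obj ?C" "Y \<in> Obj ?C" "Z \<in> Obj ?C"
    then show "Comp ?C (Assoc ?C (Tens ?C W X) Y Z) (Assoc ?C W X (Tens ?C Y Z))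
            = Comp ?C (TensA ?C (Assoc ?C W X Y) (Id ?C Z))
                (Comp ?C (Assoc ?C W (Tens ?C X Y) Z) (TensA ?C (Id ?C W) (Assoc ?C X Y Z)))"
      by (simp add: C compose_assoc_auto auto_compose auto_one)
  qed
  show ?thesis
  proof
    fix f assume "f \<in> Arr ?C"
    then show "iso_arrow ?C f" by (simp add: iso_arrow_aut_gr)
  next
    fix X assume X: "X \<in> Obj ?C"
    then obtain Y where Y: "Y \<in> auto G" "compose (carrier G) X Y = (\<lambda>g \<in> carrier G. g)"
      "compose (carrier G) Y X = (\<lambda>g \<in> carrier G. g)"
      using auto_inverse by (auto simp: C)
    moreover have "isomorphic ?C (Unit ?C) (Unit ?C)"
      unfolding isomorphic_def using Id_aut_gr_hom[OF id_in_auto] hom_arr by (auto simp: C)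
    ultimately show "\<exists>Y \<in> Obj ?C. isomorphic ?C (Tens ?C X Y) (Unit ?C) \<and>
        isomorphic ?C (Tens ?C Y X) (Unit ?C)"
      by (intro bexI[of _ Y]) (auto simp: C)
    show "Tens ?C (Unit ?C) X = X \<and> Lunit ?C X = Id ?C X"
      "Tens ?C X (Unit ?C) = X \<and> Runit ?C X = Id ?C X"
      using X by (auto simp: C compose_Id_auto)
  next
    fix X Y Z assume "X \<in> Obj ?C" "Y \<in> Obj ?C" "Z \<in> Obj ?C"
    then show "Tens ?C X (Tens ?C Y Z) = Tens ?C (Tens ?C X Y) Z \<and>
              Assoc ?C X Y Z = Id ?C (Tens ?C X (Tens ?C Y Z))"
      by (simp add: C compose_assoc_auto)
  qed
qed

end

definition abstract_kernel ::
  "('p, 'c) monoid_scheme \<Rightarrow> ('g, 'b) monoid_scheme \<Rightarrow> ('p \<Rightarrow> ('g \<Rightarrow> 'g) set) \<Rightarrow> bool" where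
  "abstract_kernel P G \<psi> \<longleftrightarrow> group P \<and> group G \<and> \<psi> \<in> hom P (Out G)"

definition obstruction_cocycle ::
  "('p, 'c) monoid_scheme \<Rightarrow> ('g, 'b) monoid_scheme \<Rightarrow> ('p \<Rightarrow> ('g \<Rightarrow> 'g) set) \<Rightarrow>
   ('p \<times> 'p \<times> 'p \<Rightarrow> 'g) \<Rightarrow> bool" where
  "obstruction_cocycle P G \<psi> k \<longleftrightarrow>
     cocycle3 P (Center G) (\<lambda>x. Out_act (\<psi> x)) k \<and>
     (\<exists>\<phi> f. (\<forall>x \<in> carrier P. \<phi> x \<in> \<psi> x) \<and>
        \<phi> \<one>\<^bsub>P\<^esub> = (\<lambda>g \<in> carrier G. g) \<and>
        f \<in> carrier P \<times> carrier P \<rightarrow> carrier G \<and>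
        (\<forall>x \<in> carrier P. \<forall>y \<in> carrier P.
           compose (carrier G) (\<phi> x) (\<phi> y)
             = compose (carrier G) (conj_aut G (f (x, y))) (\<phi> (x \<otimes>\<^bsub>P\<^esub> y))) \<and>
        (\<forall>x \<in> carrier P. \<forall>y \<in> carrier P. \<forall>z \<in> carrier P.
           \<phi> x (f (y, z)) \<otimes>\<^bsub>G\<^esub> f (x, y \<otimes>\<^bsub>P\<^esub> z)
             = k (x, y, z) \<otimes>\<^bsub>G\<^esub> f (x, y) \<otimes>\<^bsub>G\<^esub> f (x \<otimes>\<^bsub>P\<^esub> y, z)))"

definition obstruction ::
  "('p, 'c) monoid_scheme \<Rightarrow> ('g, 'b) monoid_scheme \<Rightarrow> ('p \<Rightarrow> ('g \<Rightarrow> 'g) set) \<Rightarrow>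
   ('p \<times> 'p \<times> 'p \<Rightarrow> 'g) set" where
  "obstruction P G \<psi> =
     (THE c. c \<in> carrier (H3 P (Center G) (\<lambda>x. Out_act (\<psi> x))) \<and>
             (\<exists>k \<in> c. obstruction_cocycle P G \<psi> k))"

text \<open>Sign. Write \<open>h s t : X s \<otimes> X t \<rightarrow> X (s t)\<close> for the structure arrows of the reduction of
  \<open>aut_gr G\<close>. Since composition in \<open>aut_gr G\<close> is multiplication in diagram order and
  constraints go from \<open>X \<otimes> (Y \<otimes> Z)\<close> to \<open>(X \<otimes> Y) \<otimes> Z\<close>, the reduced cocycle \<open>(id, c r s t, id)\<close>
  satisfies \<open>X r (h s t) \<otimes> h r (s t) \<otimes> c r s t = h r s \<otimes> h (r s) t\<close>, whereas the obstruction
  cocycle multiplies the opposite side. Hence the reduced cocycle pulls back into the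
  obstruction class when \<open>Pi1 (aut_gr G)\<close> is identified with the center by the module
  isomorphism \<open>(id, c, id) \<mapsto> inv c\<close>; along \<open>(id, c, id) \<mapsto> c\<close> one gets the inverse class.\<close>

definition pullback3 ::
  "('p, 'c) monoid_scheme \<Rightarrow> ('p \<Rightarrow> 's) \<Rightarrow> ('s \<times> 's \<times> 's \<Rightarrow> 'u) \<Rightarrow> 'p \<times> 'p \<times> 'p \<Rightarrow> 'u" where
  "pullback3 P \<psi> \<xi> = (\<lambda>(x, y, z) \<in> carrier P \<times> carrier P \<times> carrier P. \<xi> (\<psi> x, \<psi> y, \<psi> z))"

end

theory Submission
  imports Defs "HOL-Algebra.Product_Groups"
begin

text \<open>An arrow \<open>c : \<alpha> \<rightarrow> \<beta>\<close> of \<open>aut_gr G\<close> says \<open>\<alpha> = \<mu>\<^sub>c \<circ> \<beta>\<close>, where \<open>\<mu>\<^sub>c\<close> is conjugation by \<open>c\<close>.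
  So isomorphism classes of objects are cosets of the inner automorphisms, and the
  automorphisms of the unit object are the \<open>c\<close> with \<open>\<mu>\<^sub>c = id\<close>, the center. This gives the
  first part of the result (\<open>carrier_Pi0_aut_gr\<close>, \<open>mult_Pi0_aut_gr\<close>, \<open>carrier_Pi1_aut_gr\<close>,
  \<open>Pi_act_aut_gr\<close>).

  For the cocycle, call a pair \<open>(\<phi>, f)\<close> with \<open>\<phi> x \<in> \<psi> x\<close> and
  \<open>\<phi> x \<circ> \<phi> y = \<mu>\<^bsub>f (x, y)\<^esub> \<circ> \<phi> (x y)\<close> a lift of the kernel \<open>\<psi>\<close> (locale \<open>outer_lift\<close>). A lift has an
  obstruction, a central 3-cocycle (\<open>obst_cocycle\<close>), and two lifts of the same kernel have
  cohomologous obstructions (\<open>obst_cohomologous\<close>). Therefore the obstruction class contains the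
  obstruction of every lift with \<open>\<phi> 1 = id\<close> (\<open>obstruction_cocycle_in_obstruction\<close>).

  A stick is such a lift of the universal kernel, the identity map of the outer automorphism
  group: \<open>X s\<close> is a representative of \<open>s\<close>, and the structure arrow \<open>X s \<otimes> X t \<rightarrow> X (s t)\<close>, an arrow
  \<open>h (s, t)\<close> with \<open>X s \<circ> X t = \<mu>\<^bsub>h (s, t)\<^esub> \<circ> X (s t)\<close>, is its factor set (\<open>stick_outer_lift\<close>). The
  compatibility that defines the reduced cocycle is the equation for the obstruction of this
  lift, with the central term on the other side; hence the reduced cocycle is the inverse of the
  obstruction (\<open>reduced_cocycle_aut_gr\<close>), which the inversion in the identification of
  \<open>Pi1 (aut_gr G)\<close> with the center makes good. Finally \<open>(X \<circ> \<psi>, h \<circ> (\<psi> \<times> \<psi>))\<close> is a lift of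
  \<open>\<psi>\<close>, and its obstruction is the pullback of the universal one (\<open>pullback_lift\<close>).\<close>

section \<open>The outer automorphism group\<close>

lemma (in comm_group) alternating_product:
  assumes "a \<in> carrier G" "b \<in> carrier G" "c \<in> carrier G" "d \<in> carrier G" "e \<in> carrier G"
  shows "a \<otimes> inv b \<otimes> c \<otimes> inv d \<otimes> e = a \<otimes> c \<otimes> e \<otimes> inv (d \<otimes> b)"
  using assms by (simp add: inv_mult m_ac)

context group
begin

lemma conj_aut_apply: "g \<in> carrier G \<Longrightarrow> conj_aut G c g = c \<otimes> g \<otimes> inv c"
  by (simp add: conj_aut_def)

lemma conj_aut_in_auto:
  assumes c: "c \<in> carrier G"
  shows "conj_aut G c \<in> auto G"
proof -
  have "bij_betw (conj_aut G c) (carrier G) (carrier G)"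
  proof (rule bij_betw_byWitness[where f' = "conj_aut G (inv c)"])
    show "\<forall>g\<in>carrier G. conj_aut G (inv c) (conj_aut G c g) = g"
      using c by (simp add: conj_aut_apply conj_cancel)
    show "\<forall>g\<in>carrier G. conj_aut G c (conj_aut G (inv c) g) = g"
      using c conj_cancel[of "inv c"] by (simp add: conj_aut_apply)
  qed (use c in \<open>auto simp: conj_aut_apply\<close>)
  moreover have "conj_aut G c \<in> hom G G"
    using c by (auto simp: hom_def conj_aut_apply m_assoc simp flip: m_assoc[of "inv c" c])
  ultimately show ?thesis
    by (simp add: auto_def Bij_def conj_aut_def)
qed

lemma auto_eqI:
  assumes "\<alpha> \<in> auto G" "\<beta> \<in> auto G" "\<And>g. g \<in> carrier G \<Longrightarrow> \<alpha> g = \<beta> g"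
  shows "\<alpha> = \<beta>"
  using assms by (meson auto_ext extensionalityI)

lemma AutoGroup_mult:
  "\<alpha> \<in> auto G \<Longrightarrow> \<beta> \<in> auto G \<Longrightarrow> \<alpha> \<otimes>\<^bsub>AutoGroup G\<^esub> \<beta> = compose (carrier G) \<alpha> \<beta>"
  by (simp add: AutoGroup_def BijGroup_def auto_def)

lemma carrier_AutoGroup: "carrier (AutoGroup G) = auto G"
  by (simp add: AutoGroup_def)

lemma conj_aut_hom: "conj_aut G \<in> hom G (AutoGroup G)"
proof (rule homI)
  fix c d assume cd: "c \<in> carrier G" "d \<in> carrier G"
  then have "conj_aut G (c \<otimes> d) = compose (carrier G) (conj_aut G c) (conj_aut G d)"
    by (intro auto_eqI conj_aut_in_auto auto_compose)
      (auto simp: compose_eq conj_aut_apply inv_mult_group m_assoc)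
  with cd show "conj_aut G (c \<otimes> d) = conj_aut G c \<otimes>\<^bsub>AutoGroup G\<^esub> conj_aut G d"
    by (simp add: AutoGroup_mult conj_aut_in_auto)
qed (simp add: carrier_AutoGroup conj_aut_in_auto)

text \<open>The reason for normality is \<open>\<alpha> \<circ> \<mu>\<^sub>c = \<mu>\<^sub>d \<circ> \<alpha>\<close> for \<open>d = \<alpha> c\<close>, read from either side.\<close>

lemma Int_aut_normal: "Int_aut G \<lhd> AutoGroup G"
proof -
  interpret A: group "AutoGroup G" by (rule AutoGroup)
  interpret conj: group_hom G "AutoGroup G" "conj_aut G"
    by unfold_locales (rule conj_aut_hom)
  have sub: "subgroup (Int_aut G) (AutoGroup G)"
    unfolding Int_aut_def by (rule conj.img_is_subgroup)
  have comm: "compose (carrier G) \<alpha> (conj_aut G c) = compose (carrier G) (conj_aut G (\<alpha> c)) \<alpha>"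
    if "\<alpha> \<in> auto G" "c \<in> carrier G" for \<alpha> c
    using that
    by (intro auto_eqI auto_compose conj_aut_in_auto)
      (simp_all add: auto_closed compose_eq conj_aut_apply auto_mult auto_inv)
  have "Int_aut G #>\<^bsub>AutoGroup G\<^esub> \<alpha> = \<alpha> <#\<^bsub>AutoGroup G\<^esub> Int_aut G" if \<alpha>: "\<alpha> \<in> auto G" for \<alpha>
  proof -
    have surj: "\<alpha> ` carrier G = carrier G"
      using \<alpha> by (simp add: auto_def Bij_def bij_betw_def)
    have "Int_aut G #>\<^bsub>AutoGroup G\<^esub> \<alpha> =
        (\<lambda>d. compose (carrier G) (conj_aut G d) \<alpha>) ` \<alpha> ` carrier G"
      unfolding surj
      using \<alpha> by (auto simp: r_coset_def Int_aut_def AutoGroup_mult conj_aut_in_auto)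
    also have "\<dots> = \<alpha> <#\<^bsub>AutoGroup G\<^esub> Int_aut G"
      using \<alpha> by (auto simp: l_coset_def Int_aut_def AutoGroup_mult conj_aut_in_auto comm auto_closed)
    finally show ?thesis .
  qed
  then show ?thesis
    using sub by (intro A.normalI) (simp_all add: carrier_AutoGroup)
qed

lemma group_Out: "group (Out G)"
  unfolding Out_def by (rule normal.factorgroup_is_group[OF Int_aut_normal])

text \<open>An isomorphism class of objects of \<open>aut_gr G\<close> is a coset of the inner automorphisms,
  because \<open>Hom \<alpha> \<beta>\<close> is the set of \<open>c\<close> with \<open>\<alpha> = \<mu>\<^sub>c \<circ> \<beta>\<close> and every arrow is invertible.\<close>

lemma iso_class_aut_gr:
  assumes \<alpha>: "\<alpha> \<in> auto G"
  shows "iso_class (aut_gr G) \<alpha> = Int_aut G #>\<^bsub>AutoGroup G\<^esub> \<alpha>"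
proof (rule Set.set_eqI)
  fix \<beta>
  have flip: "(\<exists>c\<in>carrier G. \<forall>g\<in>carrier G. \<alpha> g = c \<otimes> \<beta> g \<otimes> inv c) \<longleftrightarrow>
      (\<exists>c\<in>carrier G. \<forall>g\<in>carrier G. \<beta> g = c \<otimes> \<alpha> g \<otimes> inv c)" if \<beta>: "\<beta> \<in> auto G"
    using \<alpha> \<beta> by (metis auto_closed conj_cancel inv_closed inv_inv)
  have "\<beta> \<in> iso_class (aut_gr G) \<alpha> \<longleftrightarrow>
      \<beta> \<in> auto G \<and> (\<exists>c\<in>carrier G. \<forall>g\<in>carrier G. \<alpha> g = c \<otimes> \<beta> g \<otimes> inv c)"
    using \<alpha>
    by (auto simp: iso_class_def isomorphic_def iso_arrow_aut_gr Hom_aut_gr Arr_aut_gr)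
      (simp_all add: aut_gr_def)
  also have "\<dots> \<longleftrightarrow> \<beta> \<in> auto G \<and> (\<exists>c\<in>carrier G. \<beta> = compose (carrier G) (conj_aut G c) \<alpha>)"
    using flip compose_conj_aut[OF _ \<alpha>] by blast
  also have "\<dots> \<longleftrightarrow> \<beta> \<in> Int_aut G #>\<^bsub>AutoGroup G\<^esub> \<alpha>"
    using \<alpha> by (auto simp: r_coset_def Int_aut_def AutoGroup_mult conj_aut_in_auto auto_compose)
  finally show "\<beta> \<in> iso_class (aut_gr G) \<alpha> \<longleftrightarrow> \<beta> \<in> Int_aut G #>\<^bsub>AutoGroup G\<^esub> \<alpha>" .
qed

lemma carrier_Out: "carrier (Out G) = (\<lambda>\<alpha>. Int_aut G #>\<^bsub>AutoGroup G\<^esub> \<alpha>) ` auto G"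
  by (auto simp: Out_def FactGroup_def RCOSETS_def carrier_AutoGroup)

lemma Out_class_subset_auto:
  assumes "s \<in> carrier (Out G)" "\<alpha> \<in> s"
  shows "\<alpha> \<in> auto G"
  using assms by (auto simp: carrier_Out r_coset_def Int_aut_def AutoGroup_mult conj_aut_in_auto auto_compose)

lemma Out_class_eq_coset:
  assumes "s \<in> carrier (Out G)" "\<alpha> \<in> s"
  shows "s = Int_aut G #>\<^bsub>AutoGroup G\<^esub> \<alpha>"
proof -
  obtain \<beta> where "s = Int_aut G #>\<^bsub>AutoGroup G\<^esub> \<beta>" "\<beta> \<in> auto G"
    using assms by (auto simp: carrier_Out)
  then show ?thesis
    using group.repr_independence[OF AutoGroup, of \<alpha> "Int_aut G" \<beta>] assms Int_aut_normal
    by (simp add: normal_imp_subgroup carrier_AutoGroup)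
qed

lemma Out_class_conjugate:
  assumes "s \<in> carrier (Out G)" "\<alpha> \<in> s" "\<beta> \<in> s"
  shows "\<exists>c\<in>carrier G. \<forall>g\<in>carrier G. \<beta> g = c \<otimes> \<alpha> g \<otimes> inv c"
proof -
  have "\<alpha> \<in> auto G" "\<beta> \<in> auto G" using assms Out_class_subset_auto by auto
  moreover have "\<beta> \<in> Int_aut G #>\<^bsub>AutoGroup G\<^esub> \<alpha>"
    using assms Out_class_eq_coset by metis
  ultimately show ?thesis
    by (auto simp: r_coset_def Int_aut_def AutoGroup_mult conj_aut_in_auto compose_eq
        conj_aut_apply auto_closed)
qed

lemma Out_mult_class:
  assumes "s \<in> carrier (Out G)" "t \<in> carrier (Out G)" "\<alpha> \<in> s" "\<beta> \<in> t"
  shows "s \<otimes>\<^bsub>Out G\<^esub> t = Int_aut G #>\<^bsub>AutoGroup G\<^esub> compose (carrier G) \<alpha> \<beta>"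
  using normal.rcos_sum[OF Int_aut_normal, of \<alpha> \<beta>] Out_class_eq_coset[of s \<alpha>] Out_class_eq_coset[of t \<beta>]
    Out_class_subset_auto[of s \<alpha>] Out_class_subset_auto[of t \<beta>] assms
  by (simp add: Out_def FactGroup_def carrier_AutoGroup AutoGroup_mult)

lemma auto_in_own_class: "\<alpha> \<in> auto G \<Longrightarrow> \<alpha> \<in> Int_aut G #>\<^bsub>AutoGroup G\<^esub> \<alpha>"
  using group.rcos_self[OF AutoGroup] Int_aut_normal
  by (simp add: normal_imp_subgroup carrier_AutoGroup)

lemma Out_class_nonempty: "s \<in> carrier (Out G) \<Longrightarrow> \<exists>\<alpha>. \<alpha> \<in> s"
  using auto_in_own_class by (auto simp: carrier_Out)

lemma carrier_Pi0_aut_gr: "carrier (Pi0 (aut_gr G)) = carrier (Out G)"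
proof -
  have "Obj (aut_gr G) = auto G" by (simp add: aut_gr_def)
  then show ?thesis by (simp add: Pi0_def carrier_Out iso_class_aut_gr)
qed

lemma mult_Pi0_aut_gr:
  assumes s: "s \<in> carrier (Out G)" and t: "t \<in> carrier (Out G)"
  shows "s \<otimes>\<^bsub>Pi0 (aut_gr G)\<^esub> t = s \<otimes>\<^bsub>Out G\<^esub> t"
proof -
  have tens: "Tens (aut_gr G) = compose (carrier G)" by (simp add: aut_gr_def)
  have "iso_class (aut_gr G) (compose (carrier G) \<alpha> \<beta>) = s \<otimes>\<^bsub>Out G\<^esub> t"
    if "\<alpha> \<in> s" "\<beta> \<in> t" for \<alpha> \<beta>
    using that s t Out_class_subset_auto
    by (metis Out_mult_class auto_compose iso_class_aut_gr)
  moreover obtain \<alpha> \<beta> where "\<alpha> \<in> s" "\<beta> \<in> t"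
    using s t Out_class_nonempty by blast
  ultimately show ?thesis
    by (auto simp: Pi0_def tens)
qed

lemma one_Pi0_aut_gr: "\<one>\<^bsub>Pi0 (aut_gr G)\<^esub> = \<one>\<^bsub>Out G\<^esub>"
proof -
  have unit: "Unit (aut_gr G) = \<one>\<^bsub>AutoGroup G\<^esub>"
    by (simp add: aut_gr_def AutoGroup_def BijGroup_def)
  have sub: "subgroup (Int_aut G) (AutoGroup G)"
    using Int_aut_normal by (rule normal_imp_subgroup)
  then have "Int_aut G #>\<^bsub>AutoGroup G\<^esub> \<one>\<^bsub>AutoGroup G\<^esub> = Int_aut G"
    by (simp add: AutoGroup group.coset_mult_one subgroup.subset)
  moreover have "\<one>\<^bsub>AutoGroup G\<^esub> \<in> auto G"
    by (simp add: AutoGroup_def BijGroup_def id_in_auto)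
  ultimately show ?thesis
    by (simp add: Pi0_def unit iso_class_aut_gr Out_def FactGroup_def)
qed

section \<open>The center as a module over the outer automorphism group\<close>

lemma Center_iff: "c \<in> carrier (Center G) \<longleftrightarrow> c \<in> carrier G \<and> (\<forall>g\<in>carrier G. c \<otimes> g = g \<otimes> c)"
  by (simp add: Center_def)

lemma mult_Center [simp]: "c \<otimes>\<^bsub>Center G\<^esub> d = c \<otimes> d"
  by (simp add: Center_def)

lemma one_Center [simp]: "\<one>\<^bsub>Center G\<^esub> = \<one>"
  by (simp add: Center_def)

lemma Center_closed: "c \<in> carrier (Center G) \<Longrightarrow> c \<in> carrier G"
  by (simp add: Center_iff)

lemma Center_comm: "c \<in> carrier (Center G) \<Longrightarrow> g \<in> carrier G \<Longrightarrow> g \<otimes> c = c \<otimes> g"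
  by (simp add: Center_iff)

lemma Center_left_comm:
  assumes "c \<in> carrier (Center G)" "g \<in> carrier G" "h \<in> carrier G"
  shows "g \<otimes> (c \<otimes> h) = c \<otimes> (g \<otimes> h)"
  using assms Center_closed[OF assms(1)] Center_comm[OF assms(1,2)] by (simp flip: m_assoc)

lemma Center_eq_fixed:
  "c \<in> carrier (Center G) \<longleftrightarrow> c \<in> carrier G \<and> (\<forall>g\<in>carrier G. c \<otimes> g \<otimes> inv c = g)"
proof -
  have "c \<otimes> g \<otimes> inv c = g \<longleftrightarrow> c \<otimes> g = g \<otimes> c" if "c \<in> carrier G" "g \<in> carrier G" for g
    using that inv_solve_right'[of g "c \<otimes> g" c] by simp
  then show ?thesis
    by (auto simp: Center_iff)
qed

lemma subgroup_Center: "subgroup (carrier (Center G)) G"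
proof (rule subgroupI)
  fix a assume "a \<in> carrier (Center G)"
  then have a: "a \<in> carrier G" "\<And>g. g \<in> carrier G \<Longrightarrow> a \<otimes> g \<otimes> inv a = g"
    unfolding Center_eq_fixed by auto
  have "inv a \<otimes> g \<otimes> inv (inv a) = g" if "g \<in> carrier G" for g
    using conj_cancel[OF a(1) that] a that by simp
  with a show "inv a \<in> carrier (Center G)"
    unfolding Center_eq_fixed by simp
next
  fix a b assume "a \<in> carrier (Center G)" "b \<in> carrier (Center G)"
  then have ab: "a \<in> carrier G" "b \<in> carrier G"
      and comm: "\<And>g. g \<in> carrier G \<Longrightarrow> a \<otimes> g = g \<otimes> a" "\<And>g. g \<in> carrier G \<Longrightarrow> b \<otimes> g = g \<otimes> b"
    by (auto simp: Center_iff)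
  have "a \<otimes> b \<otimes> g = g \<otimes> (a \<otimes> b)" if g: "g \<in> carrier G" for g
  proof -
    have "a \<otimes> b \<otimes> g = a \<otimes> g \<otimes> b" using ab g comm(2)[OF g] by (simp add: m_assoc)
    also have "\<dots> = g \<otimes> (a \<otimes> b)" using ab g comm(1)[OF g] by (simp add: m_assoc)
    finally show ?thesis .
  qed
  with ab show "a \<otimes> b \<in> carrier (Center G)" by (simp add: Center_iff)
next
  have "\<one> \<in> carrier (Center G)" by (simp add: Center_iff)
  then show "carrier (Center G) \<noteq> {}" by blast
qed (simp add: Center_def)

lemma comm_group_Center: "comm_group (Center G)"
proof (rule group.group_comm_groupI)
  show "group (Center G)"
    using subgroup.subgroup_is_group[OF subgroup_Center is_group] by (simp add: Center_def)
next
  fix x y assume "x \<in> carrier (Center G)" "y \<in> carrier (Center G)"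
  then show "x \<otimes>\<^bsub>Center G\<^esub> y = y \<otimes>\<^bsub>Center G\<^esub> x"
    using Center_comm[of y x] Center_closed[of x] by simp
qed

lemma inv_Center [simp]:
  assumes "c \<in> carrier (Center G)"
  shows "inv\<^bsub>Center G\<^esub> c = inv c"
  using m_inv_consistent[OF subgroup_Center assms] by (simp add: Center_def)

lemma auto_Center:
  assumes \<alpha>: "\<alpha> \<in> auto G" and c: "c \<in> carrier (Center G)"
  shows "\<alpha> c \<in> carrier (Center G)"
  unfolding Center_iff
proof (intro conjI ballI)
  show "\<alpha> c \<in> carrier G" using auto_closed[OF \<alpha> Center_closed[OF c]] .
  fix g assume "g \<in> carrier G"
  then have "g \<in> \<alpha> ` carrier G"
    using \<alpha> by (simp add: auto_def Bij_def bij_betw_def)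
  then obtain h where h: "h \<in> carrier G" "g = \<alpha> h" by blast
  then show "\<alpha> c \<otimes> g = g \<otimes> \<alpha> c"
    using auto_mult[OF \<alpha>, of c h] auto_mult[OF \<alpha>, of h c] Center_comm[OF c h(1)] Center_closed[OF c]
    by simp
qed

text \<open>Members of one outer class differ by a conjugation, which fixes every central element.\<close>

lemma Out_act_eq:
  assumes s: "s \<in> carrier (Out G)" and \<alpha>: "\<alpha> \<in> s" and c: "c \<in> carrier (Center G)"
  shows "Out_act s c = \<alpha> c"
proof -
  have \<alpha>c: "\<alpha> c \<in> carrier (Center G)"
    using auto_Center[OF Out_class_subset_auto[OF s \<alpha>] c] .
  have "\<beta> c = \<alpha> c" if \<beta>: "\<beta> \<in> s" for \<beta>
  proof -
    obtain d where d: "d \<in> carrier G" "\<beta> c = d \<otimes> \<alpha> c \<otimes> inv d"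
      using Out_class_conjugate[OF s \<alpha> \<beta>] Center_closed[OF c] by blast
    then show ?thesis
      using Center_comm[OF \<alpha>c d(1)] Center_closed[OF \<alpha>c] by (simp add: m_assoc)
  qed
  with \<alpha> have "(\<forall>\<beta>\<in>s. \<beta> c = d) \<longleftrightarrow> d = \<alpha> c" for d
    by metis
  then show ?thesis
    by (simp add: Out_act_def)
qed

lemma inv_cancel_left [simp]: "x \<in> carrier G \<Longrightarrow> y \<in> carrier G \<Longrightarrow> inv x \<otimes> (x \<otimes> y) = y"
  by (simp flip: m_assoc)

lemma inv_cancel_left' [simp]: "x \<in> carrier G \<Longrightarrow> y \<in> carrier G \<Longrightarrow> x \<otimes> (inv x \<otimes> y) = y"
  by (simp flip: m_assoc)

lemma mult_inv_eq_iff: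
  "a \<in> carrier G \<Longrightarrow> b \<in> carrier G \<Longrightarrow> c \<in> carrier G \<Longrightarrow> c = a \<otimes> inv b \<longleftrightarrow> a = c \<otimes> b"
  using inv_solve_right[of c a b] by simp

text \<open>The way in which central elements arise below: as quotients of two elements that conjugate
  in the same way.\<close>

lemma Center_if_equal_conjugation:
  assumes \<alpha>: "\<alpha> \<in> auto G" and a: "a \<in> carrier G" and b: "b \<in> carrier G"
    and conj: "\<And>g. g \<in> carrier G \<Longrightarrow> a \<otimes> \<alpha> g \<otimes> inv a = b \<otimes> \<alpha> g \<otimes> inv b"
  shows "a \<otimes> inv b \<in> carrier (Center G)"
  unfolding Center_eq_fixed
proof (intro conjI ballI)
  show "a \<otimes> inv b \<in> carrier G" using a b by simp
  fix x assume x: "x \<in> carrier G"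
  have "inv b \<otimes> x \<otimes> b \<in> \<alpha> ` carrier G"
    using \<alpha> b x by (simp add: auto_def Bij_def bij_betw_def)
  then obtain g where g: "g \<in> carrier G" "\<alpha> g = inv b \<otimes> x \<otimes> b" by force
  then show "a \<otimes> inv b \<otimes> x \<otimes> inv (a \<otimes> inv b) = x"
    using conj[OF g(1)] a b x by (simp add: m_assoc inv_mult_group)
qed

end

section \<open>Lifts of an abstract kernel\<close>

text \<open>The map \<open>f\<close> measures the failure of \<open>\<phi>\<close> to be a homomorphism; for the kernel of an
  extension with \<open>\<phi>\<close> given by a section, it would be the factor set of that section.\<close>

locale outer_lift =
  fixes G :: "('g, 'b) monoid_scheme" (structure) and P :: "('p, 'c) monoid_scheme"
    and \<psi> :: "'p \<Rightarrow> ('g \<Rightarrow> 'g) set" and \<phi> :: "'p \<Rightarrow> 'g \<Rightarrow> 'g" and f :: "'p \<times> 'p \<Rightarrow> 'g"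
  assumes kernel: "abstract_kernel P G \<psi>"
    and lift: "x \<in> carrier P \<Longrightarrow> \<phi> x \<in> \<psi> x"
    and defect_closed: "x \<in> carrier P \<Longrightarrow> y \<in> carrier P \<Longrightarrow> f (x, y) \<in> carrier G"
    and defect: "x \<in> carrier P \<Longrightarrow> y \<in> carrier P \<Longrightarrow> g \<in> carrier G \<Longrightarrow>
       \<phi> x (\<phi> y g) = f (x, y) \<otimes> \<phi> (x \<otimes>\<^bsub>P\<^esub> y) g \<otimes> inv f (x, y)"

sublocale outer_lift \<subseteq> group G
  using kernel by (simp add: abstract_kernel_def)

sublocale outer_lift \<subseteq> P: group P
  using kernel by (simp add: abstract_kernel_def)

context outer_lift
begin

lemma \<psi>_closed: "x \<in> carrier P \<Longrightarrow> \<psi> x \<in> carrier (Out G)"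
  using kernel by (auto simp: abstract_kernel_def hom_def)

lemma \<phi>_auto: "x \<in> carrier P \<Longrightarrow> \<phi> x \<in> auto G"
  using lift \<psi>_closed Out_class_subset_auto by blast

lemma Out_act_lift:
  "x \<in> carrier P \<Longrightarrow> c \<in> carrier (Center G) \<Longrightarrow> Out_act (\<psi> x) c = \<phi> x c"
  using lift \<psi>_closed Out_act_eq by blast

lemmas \<phi>_simps = auto_closed[OF \<phi>_auto] auto_mult[OF \<phi>_auto] auto_inv[OF \<phi>_auto]
  auto_Center[OF \<phi>_auto] defect_closed

definition obst :: "'p \<times> 'p \<times> 'p \<Rightarrow> 'g" where
  "obst = (\<lambda>(x, y, z) \<in> carrier P \<times> carrier P \<times> carrier P.
     \<phi> x (f (y, z)) \<otimes> f (x, y \<otimes>\<^bsub>P\<^esub> z) \<otimes> inv (f (x, y) \<otimes> f (x \<otimes>\<^bsub>P\<^esub> y, z)))"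

lemma obst_iff:
  assumes "x \<in> carrier P" "y \<in> carrier P" "z \<in> carrier P" "c \<in> carrier G"
  shows "c = obst (x, y, z) \<longleftrightarrow>
    \<phi> x (f (y, z)) \<otimes> f (x, y \<otimes>\<^bsub>P\<^esub> z) = c \<otimes> f (x, y) \<otimes> f (x \<otimes>\<^bsub>P\<^esub> y, z)"
  using assms mult_inv_eq_iff[of "\<phi> x (f (y, z)) \<otimes> f (x, y \<otimes>\<^bsub>P\<^esub> z)" "f (x, y) \<otimes> f (x \<otimes>\<^bsub>P\<^esub> y, z)" c]
  by (simp add: obst_def \<phi>_simps m_assoc)

text \<open>Both sides of the equation defining the obstruction conjugate
  \<open>\<phi> (x y z)\<close> into \<open>\<phi> x \<circ> \<phi> y \<circ> \<phi> z\<close>, so their quotient is central.\<close>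

lemma obst_Center:
  assumes [simp]: "x \<in> carrier P" "y \<in> carrier P" "z \<in> carrier P"
  shows "obst (x, y, z) \<in> carrier (Center G)"
proof -
  let ?a = "\<phi> x (f (y, z)) \<otimes> f (x, y \<otimes>\<^bsub>P\<^esub> z)" and ?b = "f (x, y) \<otimes> f (x \<otimes>\<^bsub>P\<^esub> y, z)"
  have "?a \<otimes> \<phi> (x \<otimes>\<^bsub>P\<^esub> y \<otimes>\<^bsub>P\<^esub> z) g \<otimes> inv ?a = ?b \<otimes> \<phi> (x \<otimes>\<^bsub>P\<^esub> y \<otimes>\<^bsub>P\<^esub> z) g \<otimes> inv ?b"
    if [simp]: "g \<in> carrier G" for g
  proof -
    have "?a \<otimes> \<phi> (x \<otimes>\<^bsub>P\<^esub> y \<otimes>\<^bsub>P\<^esub> z) g \<otimes> inv ?a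
        = \<phi> x (f (y, z)) \<otimes> \<phi> x (\<phi> (y \<otimes>\<^bsub>P\<^esub> z) g) \<otimes> inv \<phi> x (f (y, z))"
      by (simp add: defect \<phi>_simps m_assoc inv_mult_group P.m_assoc)
    also have "\<dots> = \<phi> x (\<phi> y (\<phi> z g))"
      by (simp add: defect[of y z] \<phi>_simps)
    also have "\<dots> = ?b \<otimes> \<phi> (x \<otimes>\<^bsub>P\<^esub> y \<otimes>\<^bsub>P\<^esub> z) g \<otimes> inv ?b"
      by (simp add: defect[of x y] defect[of "x \<otimes>\<^bsub>P\<^esub> y" z] \<phi>_simps m_assoc inv_mult_group)
    finally show ?thesis .
  qed
  then show ?thesis
    using Center_if_equal_conjugation[OF \<phi>_auto, of "x \<otimes>\<^bsub>P\<^esub> y \<otimes>\<^bsub>P\<^esub> z" ?a ?b]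
    by (simp add: obst_def \<phi>_simps)
qed

lemma obst_equation:
  assumes "x \<in> carrier P" "y \<in> carrier P" "z \<in> carrier P"
  shows "\<phi> x (f (y, z)) \<otimes> f (x, y \<otimes>\<^bsub>P\<^esub> z) = obst (x, y, z) \<otimes> f (x, y) \<otimes> f (x \<otimes>\<^bsub>P\<^esub> y, z)"
  using obst_iff[OF assms] obst_Center[OF assms] Center_closed by blast

lemma obst_cochain: "obst \<in> cochains3 P (Center G)"
proof -
  have "obst \<in> extensional (carrier P \<times> carrier P \<times> carrier P)" by (simp add: obst_def)
  then show ?thesis using obst_Center by (auto simp: cochains3_def PiE_def)
qed

text \<open>The element \<open>\<phi> x (\<phi> y (f (z, t)) f (y, z t)) f (x, y z t)\<close> is a central multiple of
  \<open>f (x, y) f (x y, z) f (x y z, t)\<close>. Reducing it from the inside and from the outside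
  gives two expressions for the central factor; the cocycle identity is their equality.\<close>

lemma obst_cocycle: "cocycle3 P (Center G) (\<lambda>x. Out_act (\<psi> x)) obst"
  unfolding cocycle3_def
proof (intro conjI ballI)
  show "obst \<in> cochains3 P (Center G)" by (rule obst_cochain)
  fix x y z t assume [simp]: "x \<in> carrier P" "y \<in> carrier P" "z \<in> carrier P" "t \<in> carrier P"
  interpret Z: comm_group "Center G" by (rule comm_group_Center)
  note [simp] = obst_Center Center_closed[OF obst_Center] auto_Center[OF \<phi>_auto]
    Center_closed[OF auto_Center[OF \<phi>_auto]]
  define w where "w = f (x, y) \<otimes> (f (x \<otimes>\<^bsub>P\<^esub> y, z) \<otimes> f (x \<otimes>\<^bsub>P\<^esub> (y \<otimes>\<^bsub>P\<^esub> z), t))"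
  define J where "J = \<phi> x (\<phi> y (f (z, t)) \<otimes> f (y, z \<otimes>\<^bsub>P\<^esub> t)) \<otimes> f (x, y \<otimes>\<^bsub>P\<^esub> (z \<otimes>\<^bsub>P\<^esub> t))"
  have w: "w \<in> carrier G" by (simp add: w_def \<phi>_simps)
  let ?k1 = "\<phi> x (obst (y, z, t))" and ?k2 = "obst (x \<otimes>\<^bsub>P\<^esub> y, z, t)"
    and ?k3 = "obst (x, y \<otimes>\<^bsub>P\<^esub> z, t)" and ?k4 = "obst (x, y, z \<otimes>\<^bsub>P\<^esub> t)" and ?k5 = "obst (x, y, z)"
  have "J = ?k1 \<otimes> \<phi> x (f (y, z)) \<otimes> (\<phi> x (f (y \<otimes>\<^bsub>P\<^esub> z, t)) \<otimes> f (x, y \<otimes>\<^bsub>P\<^esub> z \<otimes>\<^bsub>P\<^esub> t))"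
    by (simp add: J_def obst_equation[of y z t] \<phi>_simps m_assoc P.m_assoc)
  also have "\<dots> = ?k1 \<otimes> ?k3 \<otimes> (\<phi> x (f (y, z)) \<otimes> f (x, y \<otimes>\<^bsub>P\<^esub> z)) \<otimes> f (x \<otimes>\<^bsub>P\<^esub> (y \<otimes>\<^bsub>P\<^esub> z), t)"
    by (simp add: obst_equation[of x "y \<otimes>\<^bsub>P\<^esub> z" t] \<phi>_simps m_assoc
        Center_left_comm[of ?k3 "\<phi> x (f (y, z))"])
  also have "\<dots> = ?k1 \<otimes> ?k3 \<otimes> ?k5 \<otimes> w"
    by (simp add: obst_equation[of x y z] w_def \<phi>_simps m_assoc)
  finally have inside: "J = ?k1 \<otimes> ?k3 \<otimes> ?k5 \<otimes> w" .
  have "J = f (x, y) \<otimes> \<phi> (x \<otimes>\<^bsub>P\<^esub> y) (f (z, t)) \<otimes> inv f (x, y) \<otimes>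
      (\<phi> x (f (y, z \<otimes>\<^bsub>P\<^esub> t)) \<otimes> f (x, y \<otimes>\<^bsub>P\<^esub> (z \<otimes>\<^bsub>P\<^esub> t)))"
    by (simp add: J_def defect[of x y] \<phi>_simps m_assoc)
  also have "\<dots> = ?k4 \<otimes> (f (x, y) \<otimes> (\<phi> (x \<otimes>\<^bsub>P\<^esub> y) (f (z, t)) \<otimes> f (x \<otimes>\<^bsub>P\<^esub> y, z \<otimes>\<^bsub>P\<^esub> t)))"
    by (simp add: obst_equation[of x y "z \<otimes>\<^bsub>P\<^esub> t"] \<phi>_simps m_assoc Center_left_comm[of ?k4])
  also have "\<dots> = ?k4 \<otimes> ?k2 \<otimes> w"
    by (simp add: obst_equation[of "x \<otimes>\<^bsub>P\<^esub> y" z t] w_def \<phi>_simps m_assoc P.m_assoc Center_left_comm[of ?k2])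
  finally have "?k1 \<otimes> ?k3 \<otimes> ?k5 = ?k4 \<otimes> ?k2"
    using inside w by simp
  moreover have "?k1 \<otimes> inv ?k2 \<otimes> ?k3 \<otimes> inv ?k4 \<otimes> ?k5 = (?k1 \<otimes> ?k3 \<otimes> ?k5) \<otimes> inv (?k4 \<otimes> ?k2)"
    using Z.alternating_product[of ?k1 ?k2 ?k3 ?k4 ?k5]
      subgroup.m_closed[OF subgroup_Center, of ?k4 ?k2] by simp
  ultimately show "Out_act (\<psi> x) (obst (y, z, t)) \<otimes>\<^bsub>Center G\<^esub> inv\<^bsub>Center G\<^esub> obst (x \<otimes>\<^bsub>P\<^esub> y, z, t)
      \<otimes>\<^bsub>Center G\<^esub> obst (x, y \<otimes>\<^bsub>P\<^esub> z, t) \<otimes>\<^bsub>Center G\<^esub> inv\<^bsub>Center G\<^esub> obst (x, y, z \<otimes>\<^bsub>P\<^esub> t)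
      \<otimes>\<^bsub>Center G\<^esub> obst (x, y, z) = \<one>\<^bsub>Center G\<^esub>"
    by (simp add: Out_act_lift)
qed

end

section \<open>Independence of the lift\<close>

text \<open>Replacing \<open>\<phi> x\<close> by a conjugate \<open>\<mu>\<^bsub>h x\<^esub> \<circ> \<phi> x\<close> can be compensated in \<open>f\<close> without
  changing the obstruction at all.\<close>

lemma (in outer_lift) change_lift:
  assumes \<phi>': "\<And>x. x \<in> carrier P \<Longrightarrow> \<phi>' x \<in> \<psi> x"
  obtains f' where "outer_lift G P \<psi> \<phi>' f'" "outer_lift.obst G P \<phi>' f' = obst"
proof -
  have "\<exists>h. \<forall>x\<in>carrier P. h x \<in> carrier G \<and> (\<forall>g\<in>carrier G. \<phi>' x g = h x \<otimes> \<phi> x g \<otimes> inv h x)"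
    using Out_class_conjugate[OF \<psi>_closed lift \<phi>'] by (intro bchoice) blast
  then obtain h where h: "\<And>x. x \<in> carrier P \<Longrightarrow> h x \<in> carrier G"
    "\<And>x g. x \<in> carrier P \<Longrightarrow> g \<in> carrier G \<Longrightarrow> \<phi>' x g = h x \<otimes> \<phi> x g \<otimes> inv h x"
    by blast
  \<comment> \<open>solves \<open>\<mu>\<^bsub>h x\<^esub> \<circ> \<phi> x \<circ> \<mu>\<^bsub>h y\<^esub> \<circ> \<phi> y = \<mu>\<^bsub>f' (x, y)\<^esub> \<circ> \<mu>\<^bsub>h (x y)\<^esub> \<circ> \<phi> (x y)\<close>, by moving \<open>h y\<close> past \<open>\<phi> x\<close>\<close>
  define f' where "f' = (\<lambda>(x, y). h x \<otimes> \<phi> x (h y) \<otimes> f (x, y) \<otimes> inv h (x \<otimes>\<^bsub>P\<^esub> y))"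
  have L: "outer_lift G P \<psi> \<phi>' f'"
  proof
    fix x y assume [simp]: "x \<in> carrier P" "y \<in> carrier P"
    show "f' (x, y) \<in> carrier G"
      by (simp add: f'_def h \<phi>_simps)
    fix g assume [simp]: "g \<in> carrier G"
    show "\<phi>' x (\<phi>' y g) = f' (x, y) \<otimes> \<phi>' (x \<otimes>\<^bsub>P\<^esub> y) g \<otimes> inv f' (x, y)"
      by (simp add: f'_def h \<phi>_simps m_assoc inv_mult_group defect)
  qed (use kernel \<phi>' in auto)
  interpret L: outer_lift G P \<psi> \<phi>' f' by (rule L)
  have "L.obst (x, y, z) = obst (x, y, z)"
    if [simp]: "x \<in> carrier P" "y \<in> carrier P" "z \<in> carrier P" for x y z
  proof -
    let ?k = "obst (x, y, z)" and ?u = "h x \<otimes> \<phi> x (h y)"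
      and ?v = "inv h (x \<otimes>\<^bsub>P\<^esub> y \<otimes>\<^bsub>P\<^esub> z)"
    have [simp]: "?k \<in> carrier G" using obst_Center Center_closed by simp
    have "\<phi>' x (f' (y, z)) \<otimes> f' (x, y \<otimes>\<^bsub>P\<^esub> z)
        = ?u \<otimes> \<phi> x (\<phi> y (h z)) \<otimes> (\<phi> x (f (y, z)) \<otimes> f (x, y \<otimes>\<^bsub>P\<^esub> z)) \<otimes> ?v"
      by (simp add: f'_def h \<phi>_simps m_assoc P.m_assoc inv_mult_group)
    also have "\<dots> = ?k \<otimes> (?u \<otimes> \<phi> x (\<phi> y (h z)) \<otimes> f (x, y) \<otimes> f (x \<otimes>\<^bsub>P\<^esub> y, z) \<otimes> ?v)"
      using Center_left_comm[of ?k "?u \<otimes> \<phi> x (\<phi> y (h z))"] obst_Center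
      by (simp add: obst_equation h \<phi>_simps m_assoc)
    also have "\<dots> = ?k \<otimes> f' (x, y) \<otimes> f' (x \<otimes>\<^bsub>P\<^esub> y, z)"
      by (simp add: f'_def h \<phi>_simps m_assoc inv_mult_group defect)
    finally show ?thesis
      using L.obst_iff[of x y z ?k] by simp
  qed
  then have "L.obst = obst"
    using L.obst_cochain obst_cochain unfolding cochains3_def by (intro PiE_ext) auto
  with L show ?thesis by (rule that)
qed

text \<open>Two choices of \<open>f\<close> for the same \<open>\<phi>\<close> differ by a central 2-cochain, and its
  coboundary is the difference of the obstructions.\<close>

lemma (in outer_lift) change_defect:
  assumes "outer_lift G P \<psi> \<phi> f'"
  obtains b where "b \<in> cochains2 P (Center G)"
    "\<And>x y z. \<lbrakk>x \<in> carrier P; y \<in> carrier P; z \<in> carrier P\<rbrakk> \<Longrightarrow>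
       outer_lift.obst G P \<phi> f' (x, y, z)
         = coboundary2 P (Center G) (\<lambda>x. Out_act (\<psi> x)) b (x, y, z) \<otimes> obst (x, y, z)"
proof
  interpret L: outer_lift G P \<psi> \<phi> f' by fact
  define b where "b = (\<lambda>(x, y) \<in> carrier P \<times> carrier P. f' (x, y) \<otimes> inv f (x, y))"
  have b: "b (x, y) \<in> carrier (Center G)" if [simp]: "x \<in> carrier P" "y \<in> carrier P" for x y
  proof -
    have "f' (x, y) \<otimes> \<phi> (x \<otimes>\<^bsub>P\<^esub> y) g \<otimes> inv f' (x, y) = f (x, y) \<otimes> \<phi> (x \<otimes>\<^bsub>P\<^esub> y) g \<otimes> inv f (x, y)"
      if "g \<in> carrier G" for g
      using that by (simp flip: defect L.defect)
    then show ?thesis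
      using Center_if_equal_conjugation[OF \<phi>_auto, of "x \<otimes>\<^bsub>P\<^esub> y" "f' (x, y)" "f (x, y)"]
      by (simp add: b_def defect_closed L.defect_closed)
  qed
  have "b \<in> extensional (carrier P \<times> carrier P)" by (simp add: b_def)
  then show "b \<in> cochains2 P (Center G)"
    using b by (auto simp: cochains2_def PiE_def)
  fix x y z assume [simp]: "x \<in> carrier P" "y \<in> carrier P" "z \<in> carrier P"
  interpret Z: comm_group "Center G" by (rule comm_group_Center)
  have f': "f' (x, y) = b (x, y) \<otimes> f (x, y)" if "x \<in> carrier P" "y \<in> carrier P" for x y
    using that by (simp add: b_def m_assoc defect_closed L.defect_closed)
  note [simp] = b Center_closed[OF b] obst_Center Center_closed[OF obst_Center]
    auto_Center[OF \<phi>_auto] Center_closed[OF auto_Center[OF \<phi>_auto]]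
  let ?b1 = "\<phi> x (b (y, z))" and ?b2 = "b (x \<otimes>\<^bsub>P\<^esub> y, z)" and ?b3 = "b (x, y \<otimes>\<^bsub>P\<^esub> z)"
    and ?b4 = "b (x, y)" and ?k = "obst (x, y, z)"
  let ?db = "coboundary2 P (Center G) (\<lambda>x. Out_act (\<psi> x)) b (x, y, z)"
  have db: "?db = ?b1 \<otimes> inv ?b2 \<otimes> ?b3 \<otimes> inv ?b4"
    by (simp add: coboundary2_def Out_act_lift)
  have [simp]: "?db \<in> carrier (Center G)"
    using Z.m_closed Z.inv_closed by (simp add: db)
  have b42: "?b4 \<otimes> ?b2 \<in> carrier (Center G)"
    using subgroup.m_closed[OF subgroup_Center] by simp
  have "?db = ?b1 \<otimes> ?b3 \<otimes> inv (?b4 \<otimes> ?b2)"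
    using Z.alternating_product[of ?b1 ?b2 ?b3 ?b4 \<one>] Z.one_closed b42 by (simp add: db)
  then have db_mult: "?db \<otimes> (?b4 \<otimes> ?b2) = ?b1 \<otimes> ?b3"
    using Center_closed[OF b42] by (simp add: m_assoc)
  have "\<phi> x (f' (y, z)) \<otimes> f' (x, y \<otimes>\<^bsub>P\<^esub> z)
      = ?b1 \<otimes> ?b3 \<otimes> (\<phi> x (f (y, z)) \<otimes> f (x, y \<otimes>\<^bsub>P\<^esub> z))"
    by (simp add: f' \<phi>_simps m_assoc Center_left_comm[of ?b3])
  also have "\<dots> = ?db \<otimes> (?b4 \<otimes> ?b2) \<otimes> (?k \<otimes> f (x, y) \<otimes> f (x \<otimes>\<^bsub>P\<^esub> y, z))"
    by (simp add: db_mult obst_equation)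
  also have "\<dots> = (?db \<otimes> ?k) \<otimes> f' (x, y) \<otimes> f' (x \<otimes>\<^bsub>P\<^esub> y, z)"
    by (simp add: f' \<phi>_simps m_assoc Center_closed Center_left_comm[of ?k ?b2]
        Center_left_comm[of ?k ?b4] Center_left_comm[of ?b2 "f (x, y)"])
  finally show "L.obst (x, y, z) = ?db \<otimes> ?k"
    using L.obst_iff[of x y z "?db \<otimes> ?k"] by (simp add: Center_closed)
qed

text \<open>First replace \<open>\<phi>\<close> by \<open>\<phi>'\<close> without changing the obstruction, then compare the two factor
  sets that belong to \<open>\<phi>'\<close>.\<close>

theorem (in outer_lift) obst_cohomologous:
  assumes L': "outer_lift G P \<psi> \<phi>' f'"
  obtains b where "b \<in> cochains2 P (Center G)"
    "\<And>x y z. \<lbrakk>x \<in> carrier P; y \<in> carrier P; z \<in> carrier P\<rbrakk> \<Longrightarrow>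
       outer_lift.obst G P \<phi>' f' (x, y, z)
         = coboundary2 P (Center G) (\<lambda>x. Out_act (\<psi> x)) b (x, y, z) \<otimes> obst (x, y, z)"
proof -
  obtain f'' where f'': "outer_lift G P \<psi> \<phi>' f''" "outer_lift.obst G P \<phi>' f'' = obst"
    using change_lift outer_lift.lift[OF L'] by metis
  show ?thesis
    using outer_lift.change_defect[OF f''(1) L'] that unfolding f''(2) by metis
qed

section \<open>Cosets of coboundaries\<close>

lemma coboundary2_hom:
  assumes P: "group P" and A: "comm_group A" and act: "\<And>x. x \<in> carrier P \<Longrightarrow> act x \<in> hom A A"
  shows "coboundary2 P A act \<in> hom (product_group (carrier P \<times> carrier P) (\<lambda>_. A))
    (product_group (carrier P \<times> carrier P \<times> carrier P) (\<lambda>_. A))"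
proof -
  interpret P: group P by fact
  interpret A: comm_group A by fact
  have act_closed: "act x a \<in> carrier A" if "x \<in> carrier P" "a \<in> carrier A" for x a
    using act that by (auto simp: hom_def)
  have act_mult: "act x (a \<otimes>\<^bsub>A\<^esub> b) = act x a \<otimes>\<^bsub>A\<^esub> act x b"
    if "x \<in> carrier P" "a \<in> carrier A" "b \<in> carrier A" for x a b
    using act that by (auto simp: hom_def)
  show ?thesis
  proof (rule homI)
    fix g assume "g \<in> carrier (product_group (carrier P \<times> carrier P) (\<lambda>_. A))"
    then have "\<And>x y. x \<in> carrier P \<Longrightarrow> y \<in> carrier P \<Longrightarrow> g (x, y) \<in> carrier A" by auto
    then show "coboundary2 P A act g \<in> carrier (product_group (carrier P \<times> carrier P \<times> carrier P) (\<lambda>_. A))"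
      by (auto simp: coboundary2_def act_closed)
  next
    fix g h assume "g \<in> carrier (product_group (carrier P \<times> carrier P) (\<lambda>_. A))"
      "h \<in> carrier (product_group (carrier P \<times> carrier P) (\<lambda>_. A))"
    then have "\<And>x y. x \<in> carrier P \<Longrightarrow> y \<in> carrier P \<Longrightarrow> g (x, y) \<in> carrier A"
      "\<And>x y. x \<in> carrier P \<Longrightarrow> y \<in> carrier P \<Longrightarrow> h (x, y) \<in> carrier A" by auto
    then show "coboundary2 P A act (g \<otimes>\<^bsub>product_group (carrier P \<times> carrier P) (\<lambda>_. A)\<^esub> h)
      = coboundary2 P A act g \<otimes>\<^bsub>product_group (carrier P \<times> carrier P \<times> carrier P) (\<lambda>_. A)\<^esub>
        coboundary2 P A act h"
      by (intro ext) (clarsimp simp: coboundary2_def restrict_def act_closed act_mult A.inv_mult A.m_ac)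
  qed
qed

text \<open>The cosets that make up \<open>H3\<close> are cosets in the group of all 3-cochains, which has the
  same multiplication as \<open>Z3\<close>. There \<open>B3\<close> is a subgroup, as the image of a homomorphism, so a
  coset is determined by any of its members.\<close>

lemma H3_class_eq_coset:
  assumes P: "group P" and A: "comm_group A" and act: "\<And>x. x \<in> carrier P \<Longrightarrow> act x \<in> hom A A"
    and c: "c \<in> carrier (H3 P A act)" and k: "k \<in> c"
  shows "c = B3 P A act #>\<^bsub>Z3 P A act\<^esub> k"
proof -
  let ?C2 = "product_group (carrier P \<times> carrier P) (\<lambda>_. A)"
    and ?C3 = "product_group (carrier P \<times> carrier P \<times> carrier P) (\<lambda>_. A)"
  interpret A: comm_group A by fact
  interpret C3: group ?C3 by simp
  interpret d: group_hom ?C2 ?C3 "coboundary2 P A act"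
    using coboundary2_hom[OF P A act] by (intro group_hom.intro group_hom_axioms.intro) simp_all
  have "subgroup (B3 P A act) ?C3"
    using d.img_is_subgroup by (simp add: B3_def cochains2_def)
  moreover have coset: "B3 P A act #>\<^bsub>Z3 P A act\<^esub> l = B3 P A act #>\<^bsub>?C3\<^esub> l" for l
    by (simp add: r_coset_def Z3_def)
  moreover obtain l where "cocycle3 P A act l" "c = B3 P A act #>\<^bsub>Z3 P A act\<^esub> l"
    using c by (auto simp: H3_def FactGroup_def RCOSETS_def Z3_def)
  ultimately show ?thesis
    using C3.repr_independence[of k "B3 P A act" l] k by (simp add: cocycle3_def cochains3_def)
qed

lemma mem_H3_class:
  assumes "c = B3 P A act #>\<^bsub>Z3 P A act\<^esub> k" "k' \<in> cochains3 P A" "b \<in> cochains2 P A"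
    and "\<And>x y z. \<lbrakk>x \<in> carrier P; y \<in> carrier P; z \<in> carrier P\<rbrakk> \<Longrightarrow>
       k' (x, y, z) = coboundary2 P A act b (x, y, z) \<otimes>\<^bsub>A\<^esub> k (x, y, z)"
  shows "k' \<in> c"
proof -
  have "k' = coboundary2 P A act b \<otimes>\<^bsub>Z3 P A act\<^esub> k"
    using assms(2,4) by (auto simp: Z3_def fun_eq_iff cochains3_def PiE_def extensional_def)
  then show ?thesis
    using assms(1,3) by (auto simp: r_coset_def B3_def)
qed

section \<open>The obstruction class\<close>

lemma (in group) Out_act_hom:
  assumes "s \<in> carrier (Out G)"
  shows "Out_act s \<in> hom (Center G) (Center G)"
proof -
  obtain \<alpha> where \<alpha>: "\<alpha> \<in> s" using Out_class_nonempty[OF assms] ..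
  then have "\<alpha> \<in> auto G" using assms Out_class_subset_auto by blast
  then show ?thesis
    using Out_act_eq[OF assms \<alpha>] subgroup.m_closed[OF subgroup_Center]
    by (auto simp: hom_def auto_Center auto_mult Center_closed)
qed

text \<open>Normalized lifts are exactly the witnesses in the definition of an obstruction cocycle;
  from right to left, the cocycle identity comes from \<open>obst_cocycle\<close>.\<close>

lemma obstruction_cocycle_iff:
  fixes G :: "('g, 'b) monoid_scheme" (structure)
  shows "obstruction_cocycle P G \<psi> k \<and> abstract_kernel P G \<psi> \<longleftrightarrow>
    (\<exists>\<phi> f. outer_lift G P \<psi> \<phi> f \<and> \<phi> \<one>\<^bsub>P\<^esub> = (\<lambda>g \<in> carrier G. g) \<and> k = outer_lift.obst G P \<phi> f)"
  (is "?L \<longleftrightarrow> ?R")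
proof
  assume L: ?L
  interpret group G using L by (simp add: abstract_kernel_def)
  obtain \<phi> f where \<phi>: "\<forall>x\<in>carrier P. \<phi> x \<in> \<psi> x" "\<phi> \<one>\<^bsub>P\<^esub> = (\<lambda>g \<in> carrier G. g)"
    and f: "f \<in> carrier P \<times> carrier P \<rightarrow> carrier G"
    and comp: "\<forall>x\<in>carrier P. \<forall>y\<in>carrier P. compose (carrier G) (\<phi> x) (\<phi> y)
             = compose (carrier G) (conj_aut G (f (x, y))) (\<phi> (x \<otimes>\<^bsub>P\<^esub> y))"
    and k: "\<forall>x\<in>carrier P. \<forall>y\<in>carrier P. \<forall>z\<in>carrier P.
           \<phi> x (f (y, z)) \<otimes> f (x, y \<otimes>\<^bsub>P\<^esub> z)
             = k (x, y, z) \<otimes> f (x, y) \<otimes> f (x \<otimes>\<^bsub>P\<^esub> y, z)"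
    using L unfolding obstruction_cocycle_def by (elim conjE exE) (rule that; assumption)
  have kc: "k \<in> cochains3 P (Center G)"
    using L by (simp add: obstruction_cocycle_def cocycle3_def)
  interpret P: group P using L by (simp add: abstract_kernel_def)
  have \<phi>a: "\<phi> x \<in> auto G" if "x \<in> carrier P" for x
    using Out_class_subset_auto[OF _ bspec[OF \<phi>(1) that]] that L by (auto simp: abstract_kernel_def hom_def)
  have is_lift: "outer_lift G P \<psi> \<phi> f"
  proof
    fix x y g assume [simp]: "x \<in> carrier P" "y \<in> carrier P" "g \<in> carrier G"
    show "\<phi> x (\<phi> y g) = f (x, y) \<otimes> \<phi> (x \<otimes>\<^bsub>P\<^esub> y) g \<otimes> inv f (x, y)"
      using fun_cong[OF comp[rule_format, of x y], of g] auto_closed[OF \<phi>a]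
      by (simp add: compose_eq conj_aut_apply)
  qed (use L \<phi> f in auto)
  interpret outer_lift G P \<psi> \<phi> f by (rule is_lift)
  have "k = obst"
  proof (rule PiE_ext)
    show kPiE: "k \<in> carrier P \<times> carrier P \<times> carrier P \<rightarrow>\<^sub>E carrier (Center G)"
      and "obst \<in> carrier P \<times> carrier P \<times> carrier P \<rightarrow>\<^sub>E carrier (Center G)"
      using kc obst_cochain by (simp_all add: cochains3_def)
    show "k w = obst w" if mem: "w \<in> carrier P \<times> carrier P \<times> carrier P" for w
    proof -
      obtain x y z where w: "w = (x, y, z)" "x \<in> carrier P" "y \<in> carrier P" "z \<in> carrier P"
        using mem by (cases w) auto
      have kw: "k (x, y, z) \<in> carrier G"
        using PiE_mem[OF kPiE mem] unfolding w(1) by (rule Center_closed)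
      show ?thesis
        unfolding w(1) by (rule iffD2[OF obst_iff[OF w(2-) kw] k[rule_format, OF w(2-)]])
    qed
  qed
  with is_lift \<phi>(2) show ?R by (intro exI conjI)
next
  assume ?R
  then obtain \<phi> f where is_lift: "outer_lift G P \<psi> \<phi> f" and one: "\<phi> \<one>\<^bsub>P\<^esub> = (\<lambda>g \<in> carrier G. g)"
    and k: "k = outer_lift.obst G P \<phi> f"
    by (elim exE conjE)
  interpret outer_lift G P \<psi> \<phi> f by (rule is_lift)
  have "compose (carrier G) (\<phi> x) (\<phi> y) = compose (carrier G) (conj_aut G (f (x, y))) (\<phi> (x \<otimes>\<^bsub>P\<^esub> y))"
    if "x \<in> carrier P" "y \<in> carrier P" for x y
  proof (rule iffD2[OF compose_conj_aut])
    show "compose (carrier G) (\<phi> x) (\<phi> y) \<in> auto G" "\<phi> (x \<otimes>\<^bsub>P\<^esub> y) \<in> auto G"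
      using that by (simp_all add: \<phi>_auto auto_compose)
    show "\<forall>g\<in>carrier G. compose (carrier G) (\<phi> x) (\<phi> y) g
        = f (x, y) \<otimes> \<phi> (x \<otimes>\<^bsub>P\<^esub> y) g \<otimes> inv f (x, y)"
      using defect[OF that] by (simp add: compose_eq)
  qed
  moreover have "f \<in> carrier P \<times> carrier P \<rightarrow> carrier G"
    using defect_closed by auto
  ultimately show ?L
    unfolding obstruction_cocycle_def k
    by (intro conjI exI[of _ \<phi>] exI[of _ f] ballI obst_cocycle lift one kernel obst_equation)
qed

text \<open>All obstruction cocycles are cohomologous, so the coset of \<open>k\<close> contains each of them, and
  it is the only class that contains one. This makes the description in \<open>obstruction\<close>
  definite.\<close>

theorem obstruction_cocycle_in_obstruction:
  assumes kernel: "abstract_kernel P G \<psi>" and k: "obstruction_cocycle P G \<psi> k"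
  shows "k \<in> obstruction P G \<psi>"
proof -
  interpret G: group G using kernel by (simp add: abstract_kernel_def)
  have P: "group P" using kernel by (simp add: abstract_kernel_def)
  let ?act = "\<lambda>x. Out_act (\<psi> x)"
  have act: "?act x \<in> hom (Center G) (Center G)" if "x \<in> carrier P" for x
    using G.Out_act_hom that kernel by (auto simp: abstract_kernel_def hom_def)
  have class_eq: "c = B3 P (Center G) ?act #>\<^bsub>Z3 P (Center G) ?act\<^esub> k"
    if "c \<in> carrier (H3 P (Center G) ?act)" "k \<in> c" for c k
    using H3_class_eq_coset[OF P G.comm_group_Center _ that] act by blast
  define c where "c = B3 P (Center G) ?act #>\<^bsub>Z3 P (Center G) ?act\<^esub> k"
  have mem: "k' \<in> c" if k': "obstruction_cocycle P G \<psi> k'" for k'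
  proof -
    obtain \<phi> f \<phi>' f' where lifts: "outer_lift G P \<psi> \<phi> f" "k = outer_lift.obst G P \<phi> f"
      "outer_lift G P \<psi> \<phi>' f'" "k' = outer_lift.obst G P \<phi>' f'"
      using kernel k k' obstruction_cocycle_iff[of P G \<psi> k] obstruction_cocycle_iff[of P G \<psi> k']
      by blast
    show ?thesis
      using outer_lift.obst_cohomologous[OF lifts(1,3)] outer_lift.obst_cochain[OF lifts(3)]
        mem_H3_class[OF c_def, of k'] unfolding lifts(2,4)
      by (metis G.mult_Center)
  qed
  have "k \<in> c" using mem k .
  moreover have "c \<in> carrier (H3 P (Center G) ?act)"
    using k by (auto simp: H3_def FactGroup_def RCOSETS_def Z3_def obstruction_cocycle_def c_def)
  moreover have "c' = c" if "c' \<in> carrier (H3 P (Center G) ?act)" "k' \<in> c'"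
    "obstruction_cocycle P G \<psi> k'" for c' k'
    using class_eq[OF that(1,2)] class_eq[OF calculation(2) mem[OF that(3)]] by simp
  ultimately have "obstruction P G \<psi> = c"
    using k unfolding obstruction_def by (intro the_equality) blast+
  with \<open>k \<in> c\<close> show ?thesis by simp
qed

section \<open>The reduced cocycle of the category of automorphisms\<close>

context group
begin

abbreviation aut_id :: "'a \<Rightarrow> 'a" where
  "aut_id \<equiv> \<lambda>g \<in> carrier G. g"

lemma inv_arrow_aut_gr:
  assumes "(\<alpha>, c, \<beta>) \<in> Arr (aut_gr G)"
  shows "inv_arrow (aut_gr G) (\<alpha>, c, \<beta>) = (\<beta>, inv c, \<alpha>)"
proof -
  have "inverse_arrows (aut_gr G) (\<alpha>, c, \<beta>) g \<longleftrightarrow> g = (\<beta>, inv c, \<alpha>)" for g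
  proof
    assume g: "inverse_arrows (aut_gr G) (\<alpha>, c, \<beta>) g"
    obtain \<beta>' d \<alpha>' where [simp]: "g = (\<beta>', d, \<alpha>')" by (cases g)
    have "d \<in> carrier G" "\<beta>' = \<beta>" "\<alpha>' = \<alpha>" "c \<otimes> d = \<one>" "c \<in> carrier G"
      using g assms by (auto simp: inverse_arrows_def Hom_def Arr_aut_gr) (auto simp: aut_gr_def)
    then show "g = (\<beta>, inv c, \<alpha>)"
      using inv_equality[of d c] inv_comm by auto
  next
    assume "g = (\<beta>, inv c, \<alpha>)"
    then show "inverse_arrows (aut_gr G) (\<alpha>, c, \<beta>) g"
      using assms unfolding inverse_arrows_def Arr_aut_gr Hom_aut_gr
      by (auto simp: aut_gr_def conj_cancel auto_closed)
  qed
  then show ?thesis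
    unfolding inv_arrow_def by (intro the_equality) simp_all
qed

lemma Arr_one: "\<alpha> \<in> auto G \<Longrightarrow> (\<alpha>, \<one>, \<alpha>) \<in> Arr (aut_gr G)"
  by (simp add: Arr_aut_gr auto_closed)

lemma carrier_Pi1_aut_gr:
  "carrier (Pi1 (aut_gr G)) = (\<lambda>c. (aut_id, c, aut_id)) ` carrier (Center G)"
proof -
  have "Unit (aut_gr G) = aut_id" by (simp add: aut_gr_def)
  moreover have "g = c \<otimes> g \<otimes> inv c \<longleftrightarrow> c \<otimes> g \<otimes> inv c = g" for c g by auto
  ultimately show ?thesis
    by (auto simp: Pi1_def iso_arrow_aut_gr Arr_aut_gr Hom_aut_gr id_in_auto Center_eq_fixed)
qed

text \<open>Composition in \<open>aut_gr G\<close> multiplies in diagram order, whence the interchange.\<close>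

lemma mult_Pi1_aut_gr:
  "(aut_id, c, aut_id) \<otimes>\<^bsub>Pi1 (aut_gr G)\<^esub> (aut_id, d, aut_id) = (aut_id, d \<otimes> c, aut_id)"
  by (simp add: Pi1_def aut_gr_def)

lemma gamma_aut_gr:
  "\<alpha> \<in> auto G \<Longrightarrow> c \<in> carrier G \<Longrightarrow> gamma (aut_gr G) \<alpha> (aut_id, c, aut_id) = (\<alpha>, c, \<alpha>)"
  using inv_arrow_aut_gr[OF Arr_one, of \<alpha>]
  by (simp add: gamma_def) (simp add: aut_gr_def)

lemma delta_aut_gr:
  "\<alpha> \<in> auto G \<Longrightarrow> c \<in> carrier G \<Longrightarrow> delta (aut_gr G) \<alpha> (aut_id, c, aut_id) = (\<alpha>, \<alpha> c, \<alpha>)"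
  using inv_arrow_aut_gr[OF Arr_one, of \<alpha>]
  by (simp add: delta_def) (simp add: aut_gr_def auto_closed)

lemma Pi_act_aut_gr:
  assumes s: "s \<in> carrier (Out G)" and c: "c \<in> carrier (Center G)"
  shows "Pi_act (aut_gr G) s (aut_id, c, aut_id) = (aut_id, Out_act s c, aut_id)"
proof -
  obtain \<alpha> where \<alpha>: "\<alpha> \<in> s" using Out_class_nonempty[OF s] ..
  note auto = Out_class_subset_auto[OF s]
  have act: "Out_act s c \<in> carrier (Center G)"
    using Out_act_eq[OF s \<alpha> c] auto_Center[OF auto[OF \<alpha>] c] by simp
  have "(v \<in> carrier (Pi1 (aut_gr G)) \<and>
      (\<forall>\<beta>\<in>s. gamma (aut_gr G) \<beta> v = delta (aut_gr G) \<beta> (aut_id, c, aut_id)))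
    \<longleftrightarrow> v = (aut_id, Out_act s c, aut_id)" for v
    using \<alpha> act c
    by (auto simp: carrier_Pi1_aut_gr gamma_aut_gr delta_aut_gr auto Center_closed
        simp flip: Out_act_eq[OF s _ c])
  then show ?thesis
    unfolding Pi_act_def by simp
qed

text \<open>A stick yields a lift of the identity kernel because \<open>i (X s \<otimes> X t)\<close> is an arrow between
  \<open>X (s t)\<close> and \<open>X s \<circ> X t\<close>; the element of \<open>G\<close> in its inverse is the factor set.\<close>

lemma stick_outer_lift:
  assumes stick: "stick (aut_gr G) X i"
  defines "h \<equiv> \<lambda>(s, t). fst (snd (inv_arrow (aut_gr G) (i (compose (carrier G) (X s) (X t)))))"
  shows "outer_lift G (Out G) (\<lambda>s. s) X h"
    and "\<And>s t. s \<in> carrier (Out G) \<Longrightarrow> t \<in> carrier (Out G) \<Longrightarrow>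
      inv_arrow (aut_gr G) (i (compose (carrier G) (X s) (X t)))
        = (compose (carrier G) (X s) (X t), h (s, t), X (s \<otimes>\<^bsub>Out G\<^esub> t))"
    and "X \<one>\<^bsub>Out G\<^esub> = aut_id"
proof -
  interpret Out: group "Out G" by (rule group_Out)
  have X: "X s \<in> s" if "s \<in> carrier (Out G)" for s
    using stick that by (simp add: stick_def carrier_Pi0_aut_gr)
  have Xa: "X s \<in> auto G" if "s \<in> carrier (Out G)" for s
    using Out_class_subset_auto[OF that X[OF that]] .
  have i: "i \<alpha> \<in> Hom (aut_gr G) (X s) \<alpha>" if "s \<in> carrier (Out G)" "\<alpha> \<in> s" for s \<alpha>
    using stick that by (simp add: stick_def carrier_Pi0_aut_gr)
  have h: "inv_arrow (aut_gr G) (i (compose (carrier G) (X s) (X t)))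
        = (compose (carrier G) (X s) (X t), h (s, t), X (s \<otimes>\<^bsub>Out G\<^esub> t)) \<and>
      h (s, t) \<in> carrier G \<and>
      (\<forall>g\<in>carrier G. X s (X t g) = h (s, t) \<otimes> X (s \<otimes>\<^bsub>Out G\<^esub> t) g \<otimes> inv h (s, t))"
    if s: "s \<in> carrier (Out G)" and t: "t \<in> carrier (Out G)" for s t
  proof -
    let ?XX = "compose (carrier G) (X s) (X t)"
    have st: "s \<otimes>\<^bsub>Out G\<^esub> t \<in> carrier (Out G)" using s t by simp
    have "?XX \<in> s \<otimes>\<^bsub>Out G\<^esub> t"
      using Out_mult_class[OF s t X X] s t auto_in_own_class auto_compose Xa by metis
    from i[OF st this] obtain c where c: "i ?XX = (X (s \<otimes>\<^bsub>Out G\<^esub> t), c, ?XX)"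
      "c \<in> carrier G" "\<forall>g\<in>carrier G. X (s \<otimes>\<^bsub>Out G\<^esub> t) g = c \<otimes> ?XX g \<otimes> inv c"
      by (auto simp: Hom_aut_gr)
    have "(X (s \<otimes>\<^bsub>Out G\<^esub> t), c, ?XX) \<in> Arr (aut_gr G)"
      using i[OF st \<open>?XX \<in> _\<close>] c(1) by (simp add: Hom_def)
    from inv_arrow_aut_gr[OF this] have "inv_arrow (aut_gr G) (i ?XX) = (?XX, inv c, X (s \<otimes>\<^bsub>Out G\<^esub> t))"
      by (simp add: c(1))
    moreover from this have "h (s, t) = inv c" by (simp add: h_def)
    moreover have "X s (X t g) = inv c \<otimes> X (s \<otimes>\<^bsub>Out G\<^esub> t) g \<otimes> inv (inv c)" if "g \<in> carrier G" for g
      using c(2,3) that conj_cancel[of c "?XX g"] auto_closed[OF Xa] s t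
      by (simp add: compose_eq)
    ultimately show ?thesis using c(2) by simp
  qed
  show "outer_lift G (Out G) (\<lambda>s. s) X h"
    by unfold_locales (use h X group_Out in \<open>auto simp: abstract_kernel_def hom_def is_group\<close>)
  show "inv_arrow (aut_gr G) (i (compose (carrier G) (X s) (X t)))
        = (compose (carrier G) (X s) (X t), h (s, t), X (s \<otimes>\<^bsub>Out G\<^esub> t))"
    if "s \<in> carrier (Out G)" "t \<in> carrier (Out G)" for s t
    using h[OF that] by blast
  show "X \<one>\<^bsub>Out G\<^esub> = aut_id"
    using stick by (simp add: stick_def one_Pi0_aut_gr) (simp add: aut_gr_def)
qed

text \<open>Compatibility with the associativity constraints at \<open>(r, s, t)\<close> reads
  \<open>X r (h (s, t)) h (r, s t) c = h (r, s) h (r s, t)\<close>, where \<open>\<xi> (r, s, t) = (id, c, id)\<close>;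
  this makes \<open>c\<close> the inverse of the obstruction of the lift.\<close>

lemma reduced_cocycle_aut_gr:
  assumes stick: "stick (aut_gr G) X i" and L: "outer_lift G (Out G) (\<lambda>s. s) X h"
    and h: "\<And>s t. s \<in> carrier (Out G) \<Longrightarrow> t \<in> carrier (Out G) \<Longrightarrow>
      inv_arrow (aut_gr G) (i (compose (carrier G) (X s) (X t)))
        = (compose (carrier G) (X s) (X t), h (s, t), X (s \<otimes>\<^bsub>Out G\<^esub> t))"
    and w: "w \<in> carrier (Out G) \<times> carrier (Out G) \<times> carrier (Out G)"
  shows "reduced_cocycle (aut_gr G) X i w = (aut_id, inv (outer_lift.obst G (Out G) X h w), aut_id)"
proof -
  interpret outer_lift G "Out G" "\<lambda>s. s" X h by (rule L)
  let ?O = "carrier (Out G)"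
  let ?compat = "\<lambda>\<xi>. assoc_compatible
      (gr_type (Pi0 (aut_gr G)) (Pi1 (aut_gr G)) (Pi_act (aut_gr G)) \<xi>) (aut_gr G)
      X (\<lambda>(s, u). gamma (aut_gr G) (X s) u)
      (\<lambda>s t. inv_arrow (aut_gr G) (i (Tens (aut_gr G) (X s) (X t))))"
  define \<xi>0 where "\<xi>0 = (\<lambda>w \<in> ?O \<times> ?O \<times> ?O. (aut_id, inv (obst w), aut_id))"
  have tens: "Tens (aut_gr G) = compose (carrier G)" by (simp add: aut_gr_def)
  \<comment> \<open>the hexagon of \<open>assoc_compatible\<close> at \<open>(r, s, t)\<close>, with \<open>c\<close> the element of \<open>G\<close> in \<open>\<xi> (r, s, t)\<close>\<close>
  have compat_at: "Comp (aut_gr G) (gamma (aut_gr G) (X (r \<otimes>\<^bsub>Out G\<^esub> s \<otimes>\<^bsub>Out G\<^esub> t)) (aut_id, c, aut_id))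
        (Comp (aut_gr G) (inv_arrow (aut_gr G) (i (compose (carrier G) (X r) (X (s \<otimes>\<^bsub>Out G\<^esub> t)))))
          (TensA (aut_gr G) (Id (aut_gr G) (X r))
            (inv_arrow (aut_gr G) (i (compose (carrier G) (X s) (X t))))))
      = Comp (aut_gr G) (inv_arrow (aut_gr G) (i (compose (carrier G) (X (r \<otimes>\<^bsub>Out G\<^esub> s)) (X t))))
        (Comp (aut_gr G)
          (TensA (aut_gr G) (inv_arrow (aut_gr G) (i (compose (carrier G) (X r) (X s))))
            (Id (aut_gr G) (X t)))
          (Assoc (aut_gr G) (X r) (X s) (X t)))
      \<longleftrightarrow> c = inv (obst (r, s, t))"
    if [simp]: "r \<in> ?O" "s \<in> ?O" "t \<in> ?O" and c: "c \<in> carrier (Center G)" for r s t c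
  proof -
    note [simp] = Center_closed[OF c] obst_Center Center_closed[OF obst_Center]
    let ?b = "h (r, s) \<otimes> h (r \<otimes>\<^bsub>Out G\<^esub> s, t)"
    have b: "?b \<in> carrier G" by (simp add: \<phi>_simps)
    have "?thesis \<longleftrightarrow> (X r (h (s, t)) \<otimes> h (r, s \<otimes>\<^bsub>Out G\<^esub> t) \<otimes> c = ?b
        \<longleftrightarrow> c = inv (obst (r, s, t)))"
      by (simp add: h gamma_aut_gr \<phi>_auto)
        (simp add: aut_gr_def Let_def \<phi>_auto \<phi>_simps auto_one)
    moreover have "X r (h (s, t)) \<otimes> h (r, s \<otimes>\<^bsub>Out G\<^esub> t) \<otimes> c = (obst (r, s, t) \<otimes> c) \<otimes> ?b"
      using Center_comm[OF c b] by (simp add: obst_equation \<phi>_simps m_assoc)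
    moreover have "(obst (r, s, t) \<otimes> c) \<otimes> ?b = ?b \<longleftrightarrow> obst (r, s, t) \<otimes> c = \<one>"
      using b by simp
    moreover have "obst (r, s, t) \<otimes> c = \<one> \<longleftrightarrow> c = inv (obst (r, s, t))"
    proof
      assume "obst (r, s, t) \<otimes> c = \<one>"
      then have "inv c = obst (r, s, t)" by (rule inv_equality) simp_all
      then show "c = inv (obst (r, s, t))" by (simp flip: \<open>inv c = _\<close>)
    qed simp
    ultimately show ?thesis by simp
  qed
  have compat_iff: "?compat \<xi> \<longleftrightarrow> (\<forall>w \<in> ?O \<times> ?O \<times> ?O. \<xi> w = \<xi>0 w)"
    if \<xi>: "\<xi> \<in> ?O \<times> ?O \<times> ?O \<rightarrow>\<^sub>E carrier (Pi1 (aut_gr G))" for \<xi>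
  proof -
    obtain c where c: "\<And>w. w \<in> ?O \<times> ?O \<times> ?O \<Longrightarrow> c w \<in> carrier (Center G) \<and> \<xi> w = (aut_id, c w, aut_id)"
    proof
      fix w assume "w \<in> ?O \<times> ?O \<times> ?O"
      then have "\<xi> w \<in> carrier (Pi1 (aut_gr G))" using \<xi> by blast
      then show "fst (snd (\<xi> w)) \<in> carrier (Center G) \<and> \<xi> w = (aut_id, fst (snd (\<xi> w)), aut_id)"
        by (auto simp: carrier_Pi1_aut_gr)
    qed
    have "?compat \<xi> \<longleftrightarrow> (\<forall>r\<in>?O. \<forall>s\<in>?O. \<forall>t\<in>?O. c (r, s, t) = inv (obst (r, s, t)))"
      unfolding assoc_compatible_def
      by (intro ball_cong) (simp_all add: gr_type_def carrier_Pi0_aut_gr mult_Pi0_aut_gr tens c compat_at)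
    also have "\<dots> \<longleftrightarrow> (\<forall>w \<in> ?O \<times> ?O \<times> ?O. \<xi> w = \<xi>0 w)"
      using c by (auto simp: \<xi>0_def)
    finally show ?thesis .
  qed
  have \<xi>0: "\<xi>0 \<in> ?O \<times> ?O \<times> ?O \<rightarrow>\<^sub>E carrier (Pi1 (aut_gr G))"
    using obst_Center subgroup.m_inv_closed[OF subgroup_Center]
    by (auto simp: \<xi>0_def carrier_Pi1_aut_gr)
  have "(\<xi> \<in> ?O \<times> ?O \<times> ?O \<rightarrow>\<^sub>E carrier (Pi1 (aut_gr G)) \<and> ?compat \<xi>) \<longleftrightarrow> \<xi> = \<xi>0" for \<xi>
  proof
    assume \<xi>: "\<xi> \<in> ?O \<times> ?O \<times> ?O \<rightarrow>\<^sub>E carrier (Pi1 (aut_gr G)) \<and> ?compat \<xi>"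
    then have "\<forall>w \<in> ?O \<times> ?O \<times> ?O. \<xi> w = \<xi>0 w" using compat_iff by blast
    then show "\<xi> = \<xi>0" using PiE_ext[OF conjunct1[OF \<xi>] \<xi>0] by blast
  next
    assume "\<xi> = \<xi>0"
    then show "\<xi> \<in> ?O \<times> ?O \<times> ?O \<rightarrow>\<^sub>E carrier (Pi1 (aut_gr G)) \<and> ?compat \<xi>"
      using compat_iff[OF \<xi>0] \<xi>0 by blast
  qed
  then have "reduced_cocycle (aut_gr G) X i = \<xi>0"
    unfolding reduced_cocycle_def carrier_Pi0_aut_gr by simp
  then show ?thesis using w by (simp add: \<xi>0_def)
qed

end

text \<open>A kernel that factors through \<open>\<psi>\<close> by a homomorphism \<open>\<rho>\<close> inherits the lift. For the identity
  kernel of the outer automorphism group, every kernel factors in this way, by itself.\<close>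

lemma (in outer_lift) pullback_lift:
  assumes kernel': "abstract_kernel Q G \<theta>" and \<theta>: "\<And>x. x \<in> carrier Q \<Longrightarrow> \<theta> x = \<psi> (\<rho> x)"
    and \<rho>: "\<rho> \<in> hom Q P"
  shows "outer_lift G Q \<theta> (\<phi> \<circ> \<rho>) (\<lambda>(x, y). f (\<rho> x, \<rho> y))"
    and "outer_lift.obst G Q (\<phi> \<circ> \<rho>) (\<lambda>(x, y). f (\<rho> x, \<rho> y))
      = (\<lambda>(x, y, z) \<in> carrier Q \<times> carrier Q \<times> carrier Q. obst (\<rho> x, \<rho> y, \<rho> z))"
proof -
  have \<rho>_closed: "\<rho> x \<in> carrier P" if "x \<in> carrier Q" for x
    using that \<rho> by (auto simp: hom_def)
  have \<rho>_mult: "\<rho> (x \<otimes>\<^bsub>Q\<^esub> y) = \<rho> x \<otimes>\<^bsub>P\<^esub> \<rho> y" if "x \<in> carrier Q" "y \<in> carrier Q" for x y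
    using that \<rho> by (auto simp: hom_def)
  show L: "outer_lift G Q \<theta> (\<phi> \<circ> \<rho>) (\<lambda>(x, y). f (\<rho> x, \<rho> y))"
    by unfold_locales (simp_all add: kernel' \<theta> lift \<rho>_closed \<rho>_mult defect_closed defect)
  interpret Q: group Q using kernel' by (simp add: abstract_kernel_def)
  show "outer_lift.obst G Q (\<phi> \<circ> \<rho>) (\<lambda>(x, y). f (\<rho> x, \<rho> y))
      = (\<lambda>(x, y, z) \<in> carrier Q \<times> carrier Q \<times> carrier Q. obst (\<rho> x, \<rho> y, \<rho> z))"
    by (auto simp: outer_lift.obst_def[OF L] obst_def \<rho>_closed \<rho>_mult fun_eq_iff restrict_def)
qed

section \<open>The pullback of the reduced cocycle\<close>

theorem theorem8:
  fixes P :: "('p, 'c) monoid_scheme" and G :: "('g, 'b) monoid_scheme"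
    and \<psi> :: "'p \<Rightarrow> ('g \<Rightarrow> 'g) set"
  assumes kernel: "abstract_kernel P G \<psi>"
    and stick: "stick (aut_gr G) X i"
    and reduced: "(P', C, \<xi>') = reduced_gr (aut_gr G) X i"
  shows "carrier P' = carrier (Out G) \<and>
    (\<forall>s \<in> carrier P'. \<forall>t \<in> carrier P'. s \<otimes>\<^bsub>P'\<^esub> t = s \<otimes>\<^bsub>Out G\<^esub> t) \<and>
    \<one>\<^bsub>P'\<^esub> = \<one>\<^bsub>Out G\<^esub> \<and>
    carrier C = (\<lambda>c. (\<lambda>g \<in> carrier G. g, c, \<lambda>g \<in> carrier G. g)) ` carrier (Center G) \<and>
    (let \<iota> = (\<lambda>(\<alpha>, c, \<beta>). inv\<^bsub>G\<^esub> c) in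
       \<iota> \<in> iso C (Center G) \<and>
       (\<forall>s \<in> carrier P'. \<forall>u \<in> carrier C. \<iota> (Pi_act (aut_gr G) s u) = Out_act s (\<iota> u)) \<and>
       pullback3 P \<psi> (\<iota> \<circ> \<xi>') \<in> obstruction P G \<psi>)"
proof -
  have eqs: "P' = Pi0 (aut_gr G)" "C = Pi1 (aut_gr G)" "\<xi>' = reduced_cocycle (aut_gr G) X i"
    using reduced by (simp_all add: reduced_gr_def)
  interpret group G using kernel by (simp add: abstract_kernel_def)
  interpret P: group P using kernel by (simp add: abstract_kernel_def)
  have \<psi>: "\<psi> \<in> hom P (Out G)" using kernel by (simp add: abstract_kernel_def)
  define \<iota> :: "('g \<Rightarrow> 'g) \<times> 'g \<times> ('g \<Rightarrow> 'g) \<Rightarrow> 'g" where "\<iota> = (\<lambda>(\<alpha>, c, \<beta>). inv\<^bsub>G\<^esub> c)"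
  have inv_in_Center: "inv\<^bsub>G\<^esub> c \<in> carrier (Center G)" if "c \<in> carrier (Center G)" for c
    using subgroup.m_inv_closed[OF subgroup_Center that] .
  have iso: "\<iota> \<in> iso C (Center G)"
  proof (rule isoI)
    show "\<iota> \<in> hom C (Center G)"
      unfolding eqs
      by (rule homI) (auto simp: carrier_Pi1_aut_gr mult_Pi1_aut_gr \<iota>_def inv_in_Center
          inv_mult_group Center_closed)
    show "bij_betw \<iota> (carrier C) (carrier (Center G))"
      unfolding eqs carrier_Pi1_aut_gr
      by (rule bij_betw_byWitness[where f' = "\<lambda>c. (aut_id, inv\<^bsub>G\<^esub> c, aut_id)"])
        (auto simp: \<iota>_def inv_in_Center Center_closed)
  qed
  have module: "\<iota> (Pi_act (aut_gr G) s u) = Out_act s (\<iota> u)"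
    if s: "s \<in> carrier P'" and u: "u \<in> carrier C" for s u
  proof -
    have s': "s \<in> carrier (Out G)" using s by (simp add: eqs carrier_Pi0_aut_gr)
    obtain c where c: "u = (aut_id, c, aut_id)" "c \<in> carrier (Center G)"
      using u by (auto simp: eqs carrier_Pi1_aut_gr)
    obtain \<alpha> where \<alpha>: "\<alpha> \<in> s" using Out_class_nonempty[OF s'] ..
    show ?thesis
      using c Out_class_subset_auto[OF s' \<alpha>]
      by (simp add: \<iota>_def Pi_act_aut_gr[OF s'] Out_act_eq[OF s' \<alpha>] inv_in_Center auto_inv Center_closed)
  qed
  define h where "h = (\<lambda>(s, t). fst (snd (inv_arrow (aut_gr G) (i (compose (carrier G) (X s) (X t))))))"
  note lift = stick_outer_lift[OF stick, folded h_def]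
  interpret universal: outer_lift G "Out G" "\<lambda>s. s" X h by (rule lift(1))
  note pulled = universal.pullback_lift[OF kernel refl \<psi>]
  have "\<xi>' w = (aut_id, inv\<^bsub>G\<^esub> (universal.obst w), aut_id)"
    if "w \<in> carrier (Out G) \<times> carrier (Out G) \<times> carrier (Out G)" for w
    unfolding eqs by (rule reduced_cocycle_aut_gr[OF stick lift(1,2) that])
  \<comment> \<open>the inversion in \<open>\<iota>\<close> cancels the one in the reduced cocycle\<close>
  then have "pullback3 P \<psi> (\<iota> \<circ> \<xi>')
      = (\<lambda>(x, y, z) \<in> carrier P \<times> carrier P \<times> carrier P. universal.obst (\<psi> x, \<psi> y, \<psi> z))"
    using \<psi> universal.obst_Center Center_closed
    by (auto simp: pullback3_def \<iota>_def fun_eq_iff restrict_def hom_def Pi_iff)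
  also have "\<dots> = outer_lift.obst G P (X \<circ> \<psi>) (\<lambda>(x, y). h (\<psi> x, \<psi> y))"
    by (rule pulled(2)[symmetric])
  moreover have "(X \<circ> \<psi>) \<one>\<^bsub>P\<^esub> = aut_id"
    using hom_one[OF \<psi> P.is_group group_Out] lift(3) by simp
  ultimately have "obstruction_cocycle P G \<psi> (pullback3 P \<psi> (\<iota> \<circ> \<xi>'))"
    using pulled(1) obstruction_cocycle_iff[of P G \<psi> "pullback3 P \<psi> (\<iota> \<circ> \<xi>')"] by metis
  then have "pullback3 P \<psi> (\<iota> \<circ> \<xi>') \<in> obstruction P G \<psi>"
    by (rule obstruction_cocycle_in_obstruction[OF kernel])
  with iso module show ?thesis
    unfolding \<iota>_def Let_def
    by (simp add: eqs carrier_Pi0_aut_gr mult_Pi0_aut_gr one_Pi0_aut_gr carrier_Pi1_aut_gr)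
qed

end
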